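(* Let $n > 2$ and let $w_0 = n(n-1)\cdots 321 \in \mathfrak{S}_n$ be the longest element. Then $$\min\{\mathsf{perim}(T) : T \in T(w_0)\} = 3,$$ where $\mathsf{perim}(T)$ is the number of (strong) perimeter tiles in the rhombic tiling $T$ of the Elnitsky polygon $X(w_0)$.
   Context: For $w \in \mathfrak{S}_n$, Elnitsky's polygon $X(w)$ is the equilateral $2n$-gon constructed as follows: starting at the topmost vertex, label the sides $1,\ldots,n,w(n),\ldots,w(1)$ in counterclockwise order; the first $n$ sides (labeled $1,\ldots,n$, the "leftside boundary", going from the top vertex down to the bottom vertex) form half of a convex $2n$-gon; the remaining $n$ sides (the "rightside boundary", labeled $w(1),\dots,w(n)$ from the top vertex down to the bottom vertex) are drawn so that two sides are parallel (and congruent) if and only if they have the same label. For $w_0$ this is a convex centrally symmetric $2n$-gon. A rhombic tiling of $X(w)$ is a tiling of $X(w)$ by rhombi all of whose edges are congruent and parallel to edges of $X(w)$; $T(w)$ denotes the set of rhombic tilings. A tile is a (strong) perimeter tile if it shares a path of at least two of its edges with the boundary of $X(w)$. $\mathsf{perim}(T)$ is the number of perimeter tiles of $T$. *)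

theory Defs
  imports "HOL-Analysis.Analysis"
begin

text \<open>The plane is the type of complex numbers, and polygons are normalised to side length 1
  with the topmost vertex at the origin.  The side labelled \<open>i\<close>, traversed downwards, is the
  vector \<open>cis (\<theta> i)\<close>.\<close>

definition side_angles :: "nat \<Rightarrow> (nat \<Rightarrow> real) \<Rightarrow> bool" where
  "side_angles n \<theta> \<longleftrightarrow>
     strict_mono_on {1..n} \<theta> \<and> (\<forall>i\<in>{1..n}. pi < \<theta> i \<and> \<theta> i < 2 * pi)"

text \<open>The angles lie in the open lower half plane because the leftside boundary runs down from the
  top vertex to the bottom vertex; they increase because a convex polygon traversed
  counterclockwise turns left at each vertex.\<close>

definition left_vertex :: "(nat \<Rightarrow> real) \<Rightarrow> nat \<Rightarrow> complex" where
  "left_vertex \<theta> k = (\<Sum>i=1..k. cis (\<theta> i))"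

definition right_vertex :: "(nat \<Rightarrow> real) \<Rightarrow> (nat \<Rightarrow> nat) \<Rightarrow> nat \<Rightarrow> complex" where
  "right_vertex \<theta> w k = (\<Sum>i=1..k. cis (\<theta> (w i)))"

definition elnitsky_boundary :: "nat \<Rightarrow> (nat \<Rightarrow> real) \<Rightarrow> (nat \<Rightarrow> nat) \<Rightarrow> complex set" where
  "elnitsky_boundary n \<theta> w =
     (\<Union>k\<in>{1..n}. closed_segment (left_vertex \<theta> (k - 1)) (left_vertex \<theta> k)) \<union>
     (\<Union>k\<in>{1..n}. closed_segment (right_vertex \<theta> w (k - 1)) (right_vertex \<theta> w k))"

definition elnitsky_polygon :: "nat \<Rightarrow> (nat \<Rightarrow> real) \<Rightarrow> (nat \<Rightarrow> nat) \<Rightarrow> complex set" where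
  "elnitsky_polygon n \<theta> w = elnitsky_boundary n \<theta> w \<union> inside (elnitsky_boundary n \<theta> w)"

definition parallelogram :: "complex \<Rightarrow> complex \<Rightarrow> complex \<Rightarrow> complex set" where
  "parallelogram p a b = convex hull {p, p + a, p + a + b, p + b}"

text \<open>All side vectors point downwards, so taking \<open>p\<close> to be the topmost corner, every rhombus whose
  edges are congruent and parallel to sides of the polygon is of the following form.\<close>

definition is_tile :: "nat \<Rightarrow> (nat \<Rightarrow> real) \<Rightarrow> complex set \<Rightarrow> bool" where
  "is_tile n \<theta> R \<longleftrightarrow>
     (\<exists>p. \<exists>i\<in>{1..n}. \<exists>j\<in>{1..n}. i \<noteq> j \<and> R = parallelogram p (cis (\<theta> i)) (cis (\<theta> j)))"

definition rhombic_tilings ::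
    "nat \<Rightarrow> (nat \<Rightarrow> real) \<Rightarrow> (nat \<Rightarrow> nat) \<Rightarrow> complex set set set" where
  "rhombic_tilings n \<theta> w =
     {T. finite T \<and> (\<forall>R\<in>T. is_tile n \<theta> R) \<and>
         (\<forall>R\<in>T. \<forall>S\<in>T. R \<noteq> S \<longrightarrow> interior R \<inter> interior S = {}) \<and>
         \<Union>T = elnitsky_polygon n \<theta> w}"

text \<open>A path of at least two edges contains two distinct edges meeting at a corner of the tile.\<close>

definition perimeter_tile ::
    "nat \<Rightarrow> (nat \<Rightarrow> real) \<Rightarrow> (nat \<Rightarrow> nat) \<Rightarrow> complex set \<Rightarrow> bool" where
  "perimeter_tile n \<theta> w R \<longleftrightarrow>
     (\<exists>E F. E edge_of R \<and> F edge_of R \<and> E \<noteq> F \<and> E \<inter> F \<noteq> {} \<and>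
            E \<subseteq> elnitsky_boundary n \<theta> w \<and> F \<subseteq> elnitsky_boundary n \<theta> w)"

definition perim ::
    "nat \<Rightarrow> (nat \<Rightarrow> real) \<Rightarrow> (nat \<Rightarrow> nat) \<Rightarrow> complex set set \<Rightarrow> nat" where
  "perim n \<theta> w T = card {R \<in> T. perimeter_tile n \<theta> w R}"

definition longest_perm :: "nat \<Rightarrow> nat \<Rightarrow> nat" where
  "longest_perm n i = (if i \<in> {1..n} then n + 1 - i else i)"

lemma longest_perm_permutes: "longest_perm n permutes {1..n}"
proof (rule bij_imp_permutes)
  show "bij_betw (longest_perm n) {1..n} {1..n}"
    by (rule bij_betw_byWitness[where f' = "longest_perm n"]) (auto simp: longest_perm_def)
qed (auto simp: longest_perm_def)

end

theory Submission
  imports Defs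
begin

text \<open>The polygon is a zonogon.  Number its sides \<open>k = 0, 1, \<dots>\<close> counterclockwise, with direction
  \<open>dir k\<close>, so that \<open>dir (k + n) = - dir k\<close>.  In any tiling, side \<open>k\<close> belongs to a tile whose second
  direction, pointing into the polygon, is \<open>dir (c k)\<close> with \<open>k < c k < k + n\<close>.  The tiles on two
  consecutive sides do not overlap near the common vertex, which forces \<open>c (k + 1) \<le> c k\<close> unless one
  tile fills the whole corner; then \<open>c k = k + 1\<close>, and \<open>c\<close> increases by at most \<open>n - 1\<close>.
  Once around the polygon \<open>c\<close> increases by \<open>2 n > 2 (n - 1)\<close>, so at least three corners are filled.
  The tiles filling a corner are exactly the perimeter tiles.

  The value 3 is attained by the tiling with the tiles spanned by \<open>dir i\<close>, \<open>dir j\<close>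
  (\<open>i < j < n\<close>) whose top vertex is the sum of the \<open>dir l\<close>, \<open>i < l < j\<close>.  That these tile the
  polygon follows from linear programming: write a point as a combination of
  \<open>dir 0, \<dots>, dir (n - 1)\<close> with coefficients in \<open>[0, 1]\<close> of minimal cost, where \<open>dir l\<close> costs its
  norm.  By the strict triangle inequality this combination is unique and has the form prescribed
  by one of the tiles.\<close>

subsection \<open>Oriented area and parallelograms\<close>

definition det2 :: "complex \<Rightarrow> complex \<Rightarrow> real" where
  "det2 a b = Re a * Im b - Im a * Re b"

lemma det2_eq_inner: "det2 a z = inner (\<i> * a) z"
  by (simp add: det2_def inner_complex_def)

interpretation det2: bounded_bilinear det2
proof -
  have "(\<lambda>a. inner (\<i> * a)) = det2"
    by (intro ext) (simp only: det2_eq_inner)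
  then show "bounded_bilinear det2"
    using bounded_bilinear.comp1[OF bounded_bilinear_inner bounded_linear_mult_right[of \<i>]] by metis
qed

lemmas det2_simps [simp] =
  det2.add_left det2.add_right det2.diff_left det2.diff_right det2.minus_left det2.minus_right
  det2.scaleR_left det2.scaleR_right det2.zero_left det2.zero_right

lemma det2_self [simp]: "det2 a a = 0"
  by (simp add: det2_def)

lemma det2_commute: "det2 b a = - det2 a b"
  by (simp add: det2_def)

lemma det2_cis: "det2 (cis \<alpha>) (cis \<beta>) = sin (\<beta> - \<alpha>)"
  by (simp add: det2_def sin_diff)

lemma det2_cramer: "det2 a b *\<^sub>R z = det2 z b *\<^sub>R a + det2 a z *\<^sub>R b"
  by (simp add: det2_def complex_eq_iff algebra_simps)

lemma closed_segment_0_flip: "closed_segment 0 a = {a} + closed_segment 0 (- a)"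
  for a :: "'a::real_vector"
  using closed_segment_translation[of a "- a" 0]
  by (simp add: translation_eq_singleton_plus closed_segment_commute)

lemma parallelogram_eq_set_plus:
  "parallelogram p a b = {p} + (closed_segment 0 a + closed_segment 0 b)"
proof -
  have "{p, p + a, p + a + b, p + b} = {p} + ({0, a} + {0, b})"
    by (auto simp: set_plus_def add.assoc)
  then show ?thesis
    by (simp only: parallelogram_def convex_hull_set_plus segment_convex_hull convex_hull_singleton)
qed

lemma parallelogram_swap: "parallelogram p a b = parallelogram p b a"
  by (simp only: parallelogram_eq_set_plus add.commute)

lemma parallelogram_flip: "parallelogram p a b = parallelogram (p + a) (- a) b"
proof -
  have "{p} + {a} = {p + a}"
    by (simp add: set_plus_def)
  then show ?thesis
    unfolding parallelogram_eq_set_plus closed_segment_0_flip[of a] by (metis add.assoc)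
qed

lemma mem_parallelogram:
  "z \<in> parallelogram p a b \<longleftrightarrow> (\<exists>s\<in>{0..1}. \<exists>t\<in>{0..1}. z = p + s *\<^sub>R a + t *\<^sub>R b)"
  by (fastforce simp: parallelogram_eq_set_plus set_plus_def in_segment add.assoc)

lemma corners_in_parallelogram:
  "p \<in> parallelogram p a b" "p + a \<in> parallelogram p a b"
  "p + b \<in> parallelogram p a b" "p + a + b \<in> parallelogram p a b"
  unfolding parallelogram_def by (rule hull_inc, simp)+

lemma mem_parallelogram_iff_det2:
  assumes "det2 a b > 0"
  shows "z \<in> parallelogram p a b \<longleftrightarrow>
    det2 a (z - p) \<in> {0..det2 a b} \<and> det2 (z - p) b \<in> {0..det2 a b}"
    (is "_ \<longleftrightarrow> ?bounds")
proof
  assume "z \<in> parallelogram p a b"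
  with assms show ?bounds
    unfolding mem_parallelogram by (auto simp: mult_left_le_one_le)
next
  assume bounds: ?bounds
  define s where "s = det2 (z - p) b / det2 a b"
  define t where "t = det2 a (z - p) / det2 a b"
  have "z - p = (1 / det2 a b) *\<^sub>R (det2 a b *\<^sub>R (z - p))"
    using assms by simp
  also have "\<dots> = s *\<^sub>R a + t *\<^sub>R b"
    unfolding det2_cramer[of a b "z - p"] s_def t_def
    by (simp only: scaleR_add_right scaleR_scaleR times_divide_eq_left mult_1)
  finally have "z = p + s *\<^sub>R a + t *\<^sub>R b"
    by (simp add: algebra_simps)
  moreover have "s \<in> {0..1}" "t \<in> {0..1}"
    using bounds assms by (auto simp: s_def t_def)
  ultimately show "z \<in> parallelogram p a b"
    unfolding mem_parallelogram by blast
qed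

lemma interior_parallelogram:
  assumes "det2 a b > 0"
  shows "interior (parallelogram p a b) =
    {z. det2 a (z - p) \<in> {0<..<det2 a b} \<and> det2 (z - p) b \<in> {0<..<det2 a b}}"
proof -
  have nonzero: "\<i> * a \<noteq> 0" "\<i> * b \<noteq> 0"
    using assms by auto
  have det2_a: "det2 a (z - p) = inner (\<i> * a) z - inner (\<i> * a) p" for z
    by (simp add: det2_eq_inner inner_diff_right)
  have det2_b: "det2 (z - p) b = inner (\<i> * b) p - inner (\<i> * b) z" for z
    by (subst det2_commute) (simp add: det2_eq_inner inner_diff_right)
  have "parallelogram p a b =
      {z. inner (\<i> * a) z \<ge> inner (\<i> * a) p} \<inter> {z. inner (\<i> * a) z \<le> inner (\<i> * a) p + det2 a b} \<inter>
      {z. inner (\<i> * b) z \<le> inner (\<i> * b) p} \<inter> {z. inner (\<i> * b) z \<ge> inner (\<i> * b) p - det2 a b}"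
    unfolding set_eq_iff mem_parallelogram_iff_det2[OF assms] det2_a det2_b by auto
  with nonzero show ?thesis
    unfolding det2_a det2_b by (auto simp: interior_halfspace_ge interior_halfspace_le)
qed

lemma eventually_in_interior_parallelogram:
  assumes "det2 a b > 0" and "det2 a u > 0" "det2 u b > 0"
  shows "\<forall>\<^sub>F e in at_right 0. p + e *\<^sub>R u \<in> interior (parallelogram p a b)"
proof -
  have small: "\<forall>\<^sub>F e in at_right 0. e * x < det2 a b" for x
  proof (rule order_tendstoD)
    show "((\<lambda>e. e * x) \<longlongrightarrow> 0 * x) (at_right 0)"
      by (intro tendsto_intros)
  qed (simp add: assms)
  show ?thesis
    using small[of "det2 a u"] small[of "det2 u b"] eventually_at_right_less[of 0]
    by eventually_elim (simp add: interior_parallelogram assms)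
qed

lemma interior_parallelograms_overlap:
  assumes "det2 a b > 0" "det2 a' b' > 0"
    and "det2 a' a \<ge> 0" "det2 a b' > 0" "det2 b' b \<ge> 0"
  shows "interior (parallelogram p a b) \<inter> interior (parallelogram p a' b') \<noteq> {}"
proof -
  let ?u = "a + b'"
  have "\<forall>\<^sub>F e in at_right (0::real). p + e *\<^sub>R ?u \<in> interior (parallelogram p a b)"
    using assms by (intro eventually_in_interior_parallelogram) auto
  moreover have "\<forall>\<^sub>F e in at_right (0::real). p + e *\<^sub>R ?u \<in> interior (parallelogram p a' b')"
    using assms by (intro eventually_in_interior_parallelogram) auto
  ultimately have
    "\<forall>\<^sub>F e in at_right (0::real).
       p + e *\<^sub>R ?u \<in> interior (parallelogram p a b) \<inter> interior (parallelogram p a' b')"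
    by eventually_elim blast
  then show ?thesis
    using eventually_happens'[OF trivial_limit_at_right_real] by blast
qed

lemma closed_segment_edge_of_parallelogram:
  assumes "det2 a b > 0"
  shows "closed_segment p (p + a) edge_of parallelogram p a b"
proof -
  let ?R = "parallelogram p a b" and ?line = "{z. det2 a z = det2 a p}"
  have "?R \<inter> ?line = closed_segment p (p + a)"
  proof (intro equalityI subsetI)
    fix z assume z_in_Int: "z \<in> ?R \<inter> ?line"
    then obtain s t where s_unit: "s \<in> {0..1}" and z_eq: "z = p + s *\<^sub>R a + t *\<^sub>R b"
      using mem_parallelogram by blast
    have "det2 a z = det2 a p"
      using z_in_Int by simp
    then have "t = 0"
      using assms z_eq by simp
    with s_unit z_eq show "z \<in> closed_segment p (p + a)"
      by (auto simp: in_segment algebra_simps)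
  next
    fix z assume "z \<in> closed_segment p (p + a)"
    then obtain s where s_unit: "s \<in> {0..1}" "z = p + s *\<^sub>R a + 0 *\<^sub>R b"
      by (auto simp: in_segment algebra_simps)
    then have "z \<in> ?R"
      unfolding mem_parallelogram by fastforce
    with s_unit show "z \<in> ?R \<inter> ?line"
      by simp
  qed
  moreover have "(?R \<inter> ?line) face_of ?R"
    unfolding det2_eq_inner
  proof (rule face_of_Int_supporting_hyperplane_ge)
    show "convex ?R"
      by (simp add: parallelogram_def)
    show "inner (\<i> * a) z \<ge> inner (\<i> * a) p" if "z \<in> ?R" for z
      using that assms by (simp add: mem_parallelogram_iff_det2 det2_eq_inner inner_diff_right)
  qed
  ultimately show ?thesis
    using assms by (auto simp: edge_of_def segment_convex_hull aff_dim_convex_hull aff_dim_2)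
qed

lemma parallelogram_oriented:
  obtains p' a' b' where "a' \<in> {a, - a}" "b' \<in> {b, - b}" "p' \<in> {p, p + a, p + b, p + a + b}"
    "parallelogram p a b = parallelogram p' a' b'" "0 \<le> det2 v a'" "0 \<le> det2 v b'"
proof -
  have flip_b: "parallelogram p a b = parallelogram (p + b) a (- b)" for p a
    by (metis parallelogram_flip parallelogram_swap)
  consider (none) "0 \<le> det2 v a" "0 \<le> det2 v b" | (first) "det2 v a < 0" "0 \<le> det2 v b"
    | (second) "0 \<le> det2 v a" "det2 v b < 0" | (both) "det2 v a < 0" "det2 v b < 0"
    by linarith
  then show thesis
  proof cases
    case none
    then show ?thesis
      by (intro that[of a b p]) auto
  next
    case first
    then show ?thesis
      by (intro that[of "- a" b "p + a"] parallelogram_flip) auto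
  next
    case second
    then show ?thesis
      by (intro that[of a "- b" "p + b"] flip_b) auto
  next
    case both
    have "parallelogram p a b = parallelogram (p + a + b) (- a) (- b)"
      by (simp only: parallelogram_flip[of p] flip_b[of "p + a"])
    with both show ?thesis
      by (intro that[of "- a" "- b" "p + a + b"]) auto
  qed
qed

lemma parallelogram_touching_line:
  assumes nondegenerate: "det2 a b \<noteq> 0" and v_nonzero: "v \<noteq> 0"
    and above: "\<And>z. z \<in> parallelogram p a b \<Longrightarrow> 0 \<le> det2 v (z - q)"
    and touching: "x \<in> parallelogram p a b" "x \<notin> {p, p + a, p + b, p + a + b}" "det2 v (x - q) = 0"
  obtains p' a' b' where "{a', b'} \<subseteq> {a, - a, b, - b}"
    "parallelogram p a b = parallelogram p' a' b'"
    "det2 v (p' - q) = 0" "det2 v a' = 0" "0 < det2 v b'"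
proof -
  obtain p' a' b' where oriented: "a' \<in> {a, - a}" "b' \<in> {b, - b}"
      "p' \<in> {p, p + a, p + b, p + a + b}"
    and parallelogram_eq: "parallelogram p a b = parallelogram p' a' b'"
    and nonneg: "0 \<le> det2 v a'" "0 \<le> det2 v b'"
    by (rule parallelogram_oriented)
  obtain s t where coefficients: "s \<in> {0..1}" "t \<in> {0..1}" "x = p' + s *\<^sub>R a' + t *\<^sub>R b'"
    using touching(1) unfolding parallelogram_eq mem_parallelogram by blast
  have "det2 v (p' - q) + s * det2 v a' + t * det2 v b' = 0"
    using touching(3) coefficients(3) by (simp add: algebra_simps)
  moreover have "0 \<le> det2 v (p' - q)" "0 \<le> s * det2 v a'" "0 \<le> t * det2 v b'"
    using above[unfolded parallelogram_eq, OF corners_in_parallelogram(1)] coefficients nonneg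
    by auto
  ultimately have zero_heights: "det2 v (p' - q) = 0" "s * det2 v a' = 0" "t * det2 v b' = 0"
    by linarith+
  have transversal: "det2 v a' \<noteq> 0 \<or> det2 v b' \<noteq> 0"
  proof -
    have "det2 a' b' *\<^sub>R v \<noteq> 0"
      using nondegenerate v_nonzero oriented(1,2) by auto
    then show ?thesis
      unfolding det2_cramer[of a' b' v] by (auto simp: det2_commute[of v a'])
  qed
  have "s \<noteq> 0 \<or> t \<noteq> 0"
    using touching(2) oriented(3) coefficients(3) by auto
  then consider (first) "det2 v a' = 0" | (second) "det2 v b' = 0"
    using zero_heights by auto
  then show thesis
  proof cases
    case first
    with transversal nonneg oriented(1,2) parallelogram_eq zero_heights show ?thesis
      by (intro that[of a' b' p']) auto
  next
    case second
    have "parallelogram p a b = parallelogram p' b' a'"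
      unfolding parallelogram_eq by (rule parallelogram_swap)
    with second transversal nonneg oriented(1,2) zero_heights show ?thesis
      by (intro that[of b' a' p']) auto
  qed
qed

subsection \<open>Edges of convex sets\<close>

lemma infinite_edge:
  assumes "E edge_of S"
  shows "infinite E"
proof
  assume "finite E"
  moreover have "connected E"
    using assms by (auto simp: edge_of_def intro: convex_connected face_of_imp_convex)
  ultimately have "E = {} \<or> (\<exists>a. E = {a})"
    using connected_finite_iff_sing by blast
  with assms show False
    by (auto simp: edge_of_def)
qed

lemma edges_eq_if_infinite_Int:
  assumes E_edge: "E edge_of S" and F_edge: "F edge_of S" and infinite: "infinite (E \<inter> F)"
  shows "E = F"
proof -
  have edge_eq_Int: "G = E \<inter> F" if G_edge: "G edge_of S" and Int_subset: "E \<inter> F \<subseteq> G" for G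
  proof (rule ccontr)
    assume "G \<noteq> E \<inter> F"
    moreover have "(E \<inter> F) face_of G"
      using E_edge F_edge G_edge Int_subset edge_of_imp_subset[OF G_edge]
      by (intro face_of_subset[of "E \<inter> F" S G] face_of_Int) (auto simp: edge_of_def)
    moreover have "convex G"
      using G_edge by (auto simp: edge_of_def intro: face_of_imp_convex)
    ultimately have "aff_dim (E \<inter> F) < 1"
      using G_edge face_of_aff_dim_lt[of G "E \<inter> F"] by (auto simp: edge_of_def)
    then have "aff_dim (E \<inter> F) = - 1 \<or> aff_dim (E \<inter> F) = 0"
      using aff_dim_geq[of "E \<inter> F"] by linarith
    with infinite show False
      by (metis aff_dim_empty aff_dim_eq_0 finite.emptyI finite_insert)
  qed
  show ?thesis
    using edge_eq_Int[OF E_edge] edge_eq_Int[OF F_edge] by blast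
qed

lemma supporting_hyperplane_frontier:
  fixes S :: "'a::euclidean_space set"
  assumes "convex S" "x \<in> S" "x \<in> frontier S"
  obtains a where "a \<noteq> 0" "\<And>z. z \<in> S \<Longrightarrow> inner a x \<le> inner a z"
proof (cases "interior S = {}")
  case True
  then obtain a b where "a \<noteq> 0" "S \<subseteq> {z. inner a z = b}"
    using empty_interior_subset_hyperplane[OF assms(1)] by blast
  then have "inner a z = inner a x" if "z \<in> S" for z
    using that assms(2) by blast
  with \<open>a \<noteq> 0\<close> show thesis
    by (intro that[of a]) auto
next
  case False
  then have "x \<notin> rel_interior S"
    using assms(3) by (simp add: rel_interior_nonempty_interior frontier_def)
  then show thesis
    by (rule supporting_hyperplane_rel_boundary[OF assms(1,2)]) (rule that)
qed

subsection \<open>Zonotopes\<close>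

definition zonotope :: "'i set \<Rightarrow> ('i \<Rightarrow> 'a::real_vector) \<Rightarrow> 'a set" where
  "zonotope I w = (\<Sum>l\<in>I. closed_segment 0 (w l))"

lemma zonotope_insert:
  "finite I \<Longrightarrow> l \<notin> I \<Longrightarrow> zonotope (insert l I) w = closed_segment 0 (w l) + zonotope I w"
  by (simp add: zonotope_def)

lemma zonotope_eq_combinations:
  assumes "finite I"
  shows "zonotope I w = (\<lambda>s. \<Sum>l\<in>I. s l *\<^sub>R w l) ` (I \<rightarrow> {0..1})"
proof (intro equalityI subsetI)
  fix x assume "x \<in> zonotope I w"
  then obtain y where summands: "\<forall>l\<in>I. y l \<in> closed_segment 0 (w l)" "x = sum y I"
    using assms by (auto simp: zonotope_def set_sum_alt)
  then have "\<forall>l\<in>I. \<exists>s\<in>{0..1}. y l = s *\<^sub>R w l"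
    by (force simp: in_segment)
  then obtain s where "\<forall>l\<in>I. s l \<in> {0..1} \<and> y l = s l *\<^sub>R w l"
    by metis
  then show "x \<in> (\<lambda>s. \<Sum>l\<in>I. s l *\<^sub>R w l) ` (I \<rightarrow> {0..1})"
    using summands by (intro image_eqI[of _ _ s]) auto
next
  fix x assume "x \<in> (\<lambda>s. \<Sum>l\<in>I. s l *\<^sub>R w l) ` (I \<rightarrow> {0..1})"
  then obtain s where "s \<in> I \<rightarrow> {0..1}" "x = (\<Sum>l\<in>I. s l *\<^sub>R w l)"
    by blast
  then show "x \<in> zonotope I w"
    unfolding zonotope_def set_sum_alt[OF assms]
    by (intro CollectI exI[of _ "\<lambda>l. s l *\<^sub>R w l"]) (force simp: in_segment)
qed

lemma zero_in_zonotope: "finite I \<Longrightarrow> 0 \<in> zonotope I w"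
  unfolding zonotope_eq_combinations by (rule image_eqI[of _ _ "\<lambda>_. 0"]) auto

lemma convex_zonotope: "convex (zonotope I w)"
  unfolding zonotope_def by (intro convex_set_sum convex_closed_segment)

lemma compact_set_plus:
  fixes S T :: "'a::real_normed_vector set"
  assumes "compact S" "compact T"
  shows "compact (S + T)"
proof -
  have "S + T = {x + y | x y. x \<in> S \<and> y \<in> T}"
    by (auto simp: set_plus_def)
  then show ?thesis
    using compact_sums[OF assms] by simp
qed

lemma compact_zonotope:
  fixes w :: "'i \<Rightarrow> 'a::real_normed_vector"
  shows "compact (zonotope I w)"
  unfolding zonotope_def
  by (induction I rule: infinite_finite_induct) (auto intro: compact_set_plus)

lemma zonotope_minimal_cost:
  fixes w :: "'i \<Rightarrow> 'a::real_normed_vector" and c :: "'i \<Rightarrow> real"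
  assumes finite: "finite I" and member: "x \<in> zonotope I w"
  obtains s where "s \<in> I \<rightarrow> {0..1}" "x = (\<Sum>l\<in>I. s l *\<^sub>R w l)"
    "\<And>t. t \<in> I \<rightarrow> {0..1} \<Longrightarrow> x = (\<Sum>l\<in>I. t l *\<^sub>R w l) \<Longrightarrow>
      (\<Sum>l\<in>I. s l * c l) \<le> (\<Sum>l\<in>I. t l * c l)"
proof -
  define lift where "lift = zonotope I (\<lambda>l. (w l, c l))"
  have lift_eq: "lift = (\<lambda>s. (\<Sum>l\<in>I. s l *\<^sub>R w l, \<Sum>l\<in>I. s l * c l)) ` (I \<rightarrow> {0..1})"
    unfolding lift_def zonotope_eq_combinations[OF finite]
    by (intro image_cong refl) (simp add: sum_prod)
  let ?fibre = "lift \<inter> {x} \<times> UNIV"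
  have "compact ?fibre"
    unfolding lift_def by (intro compact_Int_closed compact_zonotope closed_Times) auto
  moreover have "?fibre \<noteq> {}"
    using member unfolding lift_eq zonotope_eq_combinations[OF finite] by blast
  moreover have "continuous_on ?fibre snd"
    by (intro continuous_intros)
  ultimately obtain z where z_lowest: "z \<in> ?fibre" "\<And>z'. z' \<in> ?fibre \<Longrightarrow> snd z \<le> snd z'"
    using continuous_attains_inf[of ?fibre snd] by blast
  then obtain s where lowest: "s \<in> I \<rightarrow> {0..1}" "x = (\<Sum>l\<in>I. s l *\<^sub>R w l)"
    "snd z = (\<Sum>l\<in>I. s l * c l)"
    unfolding lift_eq by auto
  show thesis
  proof (rule that[OF lowest(1,2)])
    fix t assume "t \<in> I \<rightarrow> {0..1}" "x = (\<Sum>l\<in>I. t l *\<^sub>R w l)"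
    then have "(x, \<Sum>l\<in>I. t l * c l) \<in> ?fibre"
      unfolding lift_eq by blast
    from z_lowest(2)[OF this] show "(\<Sum>l\<in>I. s l * c l) \<le> (\<Sum>l\<in>I. t l * c l)"
      by (simp add: lowest(3))
  qed
qed

subsection \<open>Zonogons\<close>

lemma periodic_mod:
  fixes f :: "nat \<Rightarrow> 'a"
  assumes period: "\<And>k. f (k + N) = f k"
  shows "f (k mod N) = f k"
proof -
  have "f (r + q * N) = f r" for r q
  proof (induction q)
    case (Suc q)
    have "f (r + Suc q * N) = f (r + q * N + N)"
      by (simp add: algebra_simps)
    with Suc show ?case
      by (simp only: period)
  qed simp
  then show ?thesis
    by (metis mod_div_mult_eq)
qed

text \<open>The sides are numbered counterclockwise by \<open>0, 1, 2, \<dots>\<close>, periodically with period \<open>2 n\<close>;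
  their directions need not be unit vectors.\<close>

locale zonogon =
  fixes n :: nat and dir :: "nat \<Rightarrow> complex"
  assumes n_gt_1: "1 < n"
    and dir_add_n [simp]: "dir (k + n) = - dir k"
    and det2_dir_pos: "k < m \<Longrightarrow> m < k + n \<Longrightarrow> 0 < det2 (dir k) (dir m)"
begin

lemma dir_add_2n [simp]: "dir (k + 2 * n) = dir k"
  using dir_add_n[of "k + n"] by (simp add: mult_2 add.assoc)

lemma dir_nonzero [simp]: "dir k \<noteq> 0"
  using det2_dir_pos[of k "Suc k"] n_gt_1 by auto

lemma det2_dir_nonneg:
  assumes "k \<le> m" "m \<le> k + n"
  shows "0 \<le> det2 (dir k) (dir m)"
proof (cases "m = k \<or> m = k + n")
  case False
  with assms show ?thesis
    by (intro less_imp_le det2_dir_pos) auto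
qed auto

lemma det2_dir_neg:
  assumes "k + n < m" "m < k + 2 * n"
  shows "det2 (dir k) (dir m) < 0"
proof -
  obtain i where "m = i + n"
    using assms(1) le_Suc_ex[of n m] by (auto simp: add.commute)
  with assms show ?thesis
    using det2_dir_pos[of k i] by simp
qed

lemma exists_dir_index:
  assumes "a \<in> range dir"
  obtains c where "k \<le> c" "c < k + 2 * n" "a = dir c"
proof -
  have "\<exists>c\<ge>k. c < k + 2 * n \<and> a = dir c"
  proof (induction k)
    case 0
    obtain m where "a = dir m"
      using assms by blast
    then have "a = dir (m mod (2 * n))"
      by (simp add: periodic_mod[of dir])
    then show ?case
      using n_gt_1 by (intro exI[of _ "m mod (2 * n)"]) auto
  next
    case (Suc k)
    then obtain c where index: "k \<le> c" "c < k + 2 * n" "a = dir c"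
      by blast
    show ?case
    proof (cases "c = k")
      case True
      with index n_gt_1 show ?thesis
        by (intro exI[of _ "k + 2 * n"]) auto
    next
      case False
      with index show ?thesis
        by (intro exI[of _ c]) auto
    qed
  qed
  then show thesis
    using that by blast
qed

lemma dir_left_of:
  assumes "a \<in> range dir" "0 < det2 (dir k) a"
  obtains c where "k < c" "c < k + n" "a = dir c"
proof -
  obtain c where index: "k \<le> c" "c < k + 2 * n" "a = dir c"
    using exists_dir_index[OF assms(1)] .
  have "c \<noteq> k" "c \<noteq> k + n" "\<not> k + n < c"
    using assms(2) index det2_dir_neg[of k c] by auto
  with index show thesis
    by (intro that[of c]) auto
qed

lemma dir_parallel:
  assumes "a \<in> range dir" "det2 (dir k) a = 0"
  shows "a = dir k \<or> a = - dir k"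
proof -
  obtain c where index: "k \<le> c" "c < k + 2 * n" "a = dir c"
    using exists_dir_index[OF assms(1)] .
  have "\<not> (k < c \<and> c < k + n)" "\<not> k + n < c"
    using assms(2) index det2_dir_neg[of k c] det2_dir_pos[of k c] by auto
  then have "c = k \<or> c = k + n"
    using index by auto
  with index show ?thesis
    by auto
qed

lemma uminus_in_range_dir [simp]: "- a \<in> range dir \<longleftrightarrow> a \<in> range dir"
  by (metis dir_add_n minus_minus rangeE rangeI)

definition vertex :: "nat \<Rightarrow> complex" where
  "vertex k = (\<Sum>l<k. dir l)"

lemma vertex_0 [simp]: "vertex 0 = 0"
  by (simp add: vertex_def)

lemma vertex_Suc: "vertex (Suc k) = vertex k + dir k"
  by (simp add: vertex_def)

lemma vertex_diff: "i \<le> j \<Longrightarrow> vertex j - vertex i = (\<Sum>l\<in>{i..<j}. dir l)"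
  by (simp add: vertex_def sum_diff_nat_ivl lessThan_atLeast0)

lemma vertex_add_n: "vertex (k + n) = vertex n - vertex k"
  by (induction k) (simp_all add: vertex_Suc algebra_simps)

lemma vertex_add_2n [simp]: "vertex (k + 2 * n) = vertex k"
  by (simp add: mult_2 vertex_add_n flip: add.assoc)

abbreviation polygon :: "complex set" where
  "polygon \<equiv> zonotope {..<n} dir"

text \<open>Replacing the coefficient of \<open>dir k\<close> by its complement to 1 moves the base point from
  \<open>vertex k\<close> to \<open>vertex (Suc k)\<close>, so every vertex serves equally well as base point.\<close>

lemma polygon_based_at: "polygon = {vertex k} + zonotope {k..<k + n} dir"
proof (induction k)
  case 0
  show ?case
    by (simp add: lessThan_atLeast0 flip: set_zero)
next
  case (Suc k)
  let ?common = "zonotope {Suc k..<k + n} dir"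
  have "{k..<k + n} = insert k {Suc k..<k + n}"
    "{Suc k..<Suc k + n} = insert (k + n) {Suc k..<k + n}"
    using n_gt_1 by auto
  then have "zonotope {k..<k + n} dir = closed_segment 0 (dir k) + ?common"
    "zonotope {Suc k..<Suc k + n} dir = closed_segment 0 (- dir k) + ?common"
    by (simp_all add: zonotope_insert)
  then have "zonotope {k..<k + n} dir = {dir k} + zonotope {Suc k..<Suc k + n} dir"
    by (simp add: closed_segment_0_flip[of "dir k"] add.assoc)
  moreover have "{vertex (Suc k)} = {vertex k} + {dir k}"
    by (simp add: vertex_Suc set_plus_def)
  ultimately show ?case
    using Suc by (simp add: add.assoc)
qed

lemma vertex_in_polygon: "vertex k \<in> polygon"
proof -
  have "vertex k + 0 \<in> {vertex k} + zonotope {k..<k + n} dir"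
    by (intro set_plus_intro zero_in_zonotope) auto
  then show ?thesis
    by (simp flip: polygon_based_at)
qed

definition side :: "nat \<Rightarrow> complex set" where
  "side k = closed_segment (vertex k) (vertex (Suc k))"

lemma mem_side: "x \<in> side k \<longleftrightarrow> (\<exists>r\<in>{0..1}. x = vertex k + r *\<^sub>R dir k)"
  by (auto simp: side_def in_segment vertex_Suc algebra_simps Bex_def)

lemma side_mod_2n: "side (k mod (2 * n)) = side k"
  by (rule periodic_mod) (simp add: set_eq_iff mem_side)

lemma infinite_side: "infinite (side k)"
  by (simp add: side_def finite_closed_segment vertex_Suc)

lemma side_subset_polygon: "side k \<subseteq> polygon"
  unfolding side_def by (intro closed_segment_subset vertex_in_polygon convex_zonotope)

lemma functional_at_vertex:
  fixes f :: "complex \<Rightarrow> real"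
  assumes functional: "linear f" "0 \<le> f (dir k)" "\<And>m. k < m \<Longrightarrow> m < k + n \<Longrightarrow> 0 < f (dir m)"
    and in_polygon: "x \<in> polygon"
  shows "f (vertex k) \<le> f x" and "f x = f (vertex k) \<Longrightarrow> x \<in> side k"
proof -
  obtain s where s_unit: "s \<in> {k..<k + n} \<rightarrow> {0..1}"
    and x_eq: "x = vertex k + (\<Sum>l\<in>{k..<k + n}. s l *\<^sub>R dir l)"
    using in_polygon
    unfolding polygon_based_at[of k] zonotope_eq_combinations[OF finite_atLeastLessThan]
    by (auto simp: set_plus_def)
  have f_x_eq: "f x = f (vertex k) + (\<Sum>l\<in>{k..<k + n}. s l * f (dir l))"
    using functional(1) by (simp add: x_eq linear_add linear_sum linear_scale)
  have terms_nonneg: "0 \<le> s l * f (dir l)" if "l \<in> {k..<k + n}" for l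
    using that s_unit functional(2) functional(3)[of l] by (cases "l = k") (auto simp: Pi_iff)
  show "f (vertex k) \<le> f x"
    unfolding f_x_eq using sum_nonneg[of "{k..<k + n}", OF terms_nonneg] by simp
  show "x \<in> side k" if "f x = f (vertex k)"
  proof -
    have "(\<Sum>l\<in>{k..<k + n}. s l * f (dir l)) = 0"
      using that f_x_eq by simp
    then have zero_terms: "s l * f (dir l) = 0" if "l \<in> {k..<k + n}" for l
      using that terms_nonneg by (subst (asm) sum_nonneg_eq_0_iff) auto
    have "s l = 0" if "k < l" "l < k + n" for l
      using zero_terms[of l] functional(3)[OF that] that by simp
    then have "(\<Sum>l\<in>{k..<k + n}. s l *\<^sub>R dir l) = (\<Sum>l\<in>{k}. s l *\<^sub>R dir l)"
      using n_gt_1 by (intro sum.mono_neutral_right) auto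
    with s_unit n_gt_1 show ?thesis
      unfolding mem_side x_eq by (intro bexI[of _ "s k"]) (auto simp: Pi_iff)
  qed
qed

definition height :: "nat \<Rightarrow> complex \<Rightarrow> real" where
  "height k z = det2 (dir k) (z - vertex k)"

lemma height_nonneg: "x \<in> polygon \<Longrightarrow> 0 \<le> height k x"
  and side_if_height_zero: "x \<in> polygon \<Longrightarrow> height k x = 0 \<Longrightarrow> x \<in> side k"
proof -
  note det2_functional = functional_at_vertex[where f = "det2 (dir k)" and k = k,
      OF bounded_linear.linear[OF det2.bounded_linear_right] _ det2_dir_pos]
  show "x \<in> polygon \<Longrightarrow> 0 \<le> height k x"
    using det2_functional(1)[of x] by (simp add: height_def)
  show "x \<in> polygon \<Longrightarrow> height k x = 0 \<Longrightarrow> x \<in> side k"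
    using det2_functional(2)[of x] by (simp add: height_def)
qed

lemma height_side: "x \<in> side k \<Longrightarrow> height k x = 0"
  by (auto simp: mem_side height_def)

lemma inner_dir_pos_between:
  assumes "i < m" "m < k" "k < i + n" and "0 \<le> inner a (dir i)" "0 < inner a (dir k)"
  shows "0 < inner a (dir m)"
proof -
  have det2_pos: "0 < det2 (dir i) (dir k)" "0 < det2 (dir m) (dir k)" "0 < det2 (dir i) (dir m)"
    using assms(1-3) by (auto intro!: det2_dir_pos)
  have "inner a (det2 (dir i) (dir k) *\<^sub>R dir m)
      = det2 (dir m) (dir k) * inner a (dir i) + det2 (dir i) (dir m) * inner a (dir k)"
    by (simp only: det2_cramer[of "dir i" "dir k" "dir m"] inner_add_right inner_scaleR_right)
  also have "\<dots> > 0"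
    using det2_pos assms(4,5) by (intro add_nonneg_pos mult_nonneg_nonneg mult_pos_pos) auto
  finally have "0 < det2 (dir i) (dir k) * inner a (dir m)"
    by (simp only: inner_scaleR_right)
  from this det2_pos(1) show ?thesis
    by (rule zero_less_mult_pos)
qed

lemma exists_inner_dir_neg:
  assumes "a \<noteq> 0"
  shows "\<exists>l. inner a (dir l) < 0"
proof -
  have "inner a (dir 0) \<noteq> 0 \<or> inner a (dir 1) \<noteq> 0"
  proof (rule ccontr)
    assume "\<not> ?thesis"
    then have "inner a (det2 (dir 0) (dir 1) *\<^sub>R a) = 0"
      by (subst det2_cramer) (simp add: inner_add_right)
    with assms det2_dir_pos[of 0 1] n_gt_1 show False
      by simp
  qed
  then obtain i where "inner a (dir i) \<noteq> 0"
    by blast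
  then have "inner a (dir i) < 0 \<or> inner a (dir (i + n)) < 0"
    by auto
  then show ?thesis
    by blast
qed

lemma exists_supported_side:
  assumes "a \<noteq> 0"
  obtains k where "0 \<le> inner a (dir k)" "\<And>m. k < m \<Longrightarrow> m < k + n \<Longrightarrow> 0 < inner a (dir m)"
proof -
  obtain l where neg: "inner a (dir l) < 0"
    using exists_inner_dir_neg[OF assms] by blast
  have "\<exists>j. inner a (dir j) < 0 \<and> 0 \<le> inner a (dir (Suc j))"
  proof (rule ccontr)
    assume no_sign_change: "\<not> ?thesis"
    have "inner a (dir (l + i)) < 0" for i
      by (induction i) (use neg no_sign_change in \<open>auto simp: not_le\<close>)
    from this[of n] neg show False
      by simp
  qed
  then obtain j where sign_change: "inner a (dir j) < 0" "0 \<le> inner a (dir (Suc j))"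
    by blast
  show thesis
  proof (rule that[OF sign_change(2)])
    fix m assume "Suc j < m" "m < Suc j + n"
    then show "0 < inner a (dir m)"
      using inner_dir_pos_between[of "Suc j" m "j + n" a] sign_change by (cases "m = j + n") auto
  qed
qed

lemma side_subset_frontier: "side k \<subseteq> frontier polygon"
proof
  fix x assume on_side: "x \<in> side k"
  have "polygon \<subseteq> {z. inner (\<i> * dir k) z \<ge> inner (\<i> * dir k) (vertex k)}"
    using height_nonneg[of _ k] by (auto simp: height_def det2_eq_inner inner_diff_right)
  then have "interior polygon \<subseteq> {z. inner (\<i> * dir k) z > inner (\<i> * dir k) (vertex k)}"
    using interior_mono interior_halfspace_ge[of "\<i> * dir k"]
    by (metis dir_nonzero mult_eq_0_iff complex_i_not_zero)
  moreover have "inner (\<i> * dir k) x = inner (\<i> * dir k) (vertex k)"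
    using height_side[OF on_side] by (simp add: height_def det2_eq_inner inner_diff_right)
  ultimately have "x \<notin> interior polygon"
    by auto
  then show "x \<in> frontier polygon"
    using on_side side_subset_polygon closure_subset by (auto simp: frontier_def)
qed

lemma frontier_polygon: "frontier polygon = (\<Union>k<2 * n. side k)"
proof (intro equalityI subsetI)
  fix x assume in_frontier: "x \<in> frontier polygon"
  have in_polygon: "x \<in> polygon"
    using in_frontier compact_zonotope[of "{..<n}" dir]
    by (auto simp: frontier_def compact_imp_closed)
  obtain a where supporting: "a \<noteq> 0" "\<And>z. z \<in> polygon \<Longrightarrow> inner a x \<le> inner a z"
    using supporting_hyperplane_frontier[OF convex_zonotope in_polygon in_frontier] by blast
  obtain k where supported: "0 \<le> inner a (dir k)" "\<And>m. k < m \<Longrightarrow> m < k + n \<Longrightarrow> 0 < inner a (dir m)"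
    using exists_supported_side[OF supporting(1)] by blast
  note inner_functional = functional_at_vertex[where f = "inner a" and k = k,
      OF bounded_linear.linear[OF bounded_linear_inner_right] supported in_polygon]
  have "x \<in> side k"
    using inner_functional supporting(2)[OF vertex_in_polygon]
    by (intro inner_functional(2) antisym)
  then have "x \<in> side (k mod (2 * n))"
    by (simp add: side_mod_2n)
  then show "x \<in> (\<Union>k<2 * n. side k)"
    using n_gt_1 by (intro UN_I[of "k mod (2 * n)"]) auto
qed (use side_subset_frontier in blast)

lemma height_vertex_diff:
  "i \<le> j \<Longrightarrow> height k (vertex j) - height k (vertex i) = (\<Sum>l\<in>{i..<j}. det2 (dir k) (dir l))"
  by (simp add: height_def vertex_diff flip: det2.sum_right det2.diff_right)

lemma height_vertex_pos:
  assumes "k + 1 < j" "j < k + 2 * n"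
  shows "0 < height k (vertex j)"
proof (cases "j \<le> k + n")
  case True
  then have "0 < (\<Sum>l\<in>{Suc k..<j}. det2 (dir k) (dir l))"
    using assms by (intro sum_pos) (auto intro!: det2_dir_pos)
  moreover have "height k (vertex (Suc k)) = 0"
    by (simp add: height_def vertex_Suc)
  ultimately show ?thesis
    using height_vertex_diff[of "Suc k" j k] assms by simp
next
  case False
  then have "0 < (\<Sum>l\<in>{j..<k + 2 * n}. - det2 (dir k) (dir l))"
    using assms by (intro sum_pos) (auto intro!: det2_dir_neg)
  moreover have "height k (vertex (k + 2 * n)) = 0"
    by (simp add: height_def)
  ultimately show ?thesis
    using height_vertex_diff[of j "k + 2 * n" k] assms by (simp add: sum_negf)
qed

lemma sides_meet_imp_consecutive:
  assumes "k < m" "m < k + 2 * n" and meeting: "side k \<inter> side m \<noteq> {}"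
  shows "m = Suc k \<or> k + 2 * n = Suc m"
proof (rule ccontr)
  assume "\<not> ?thesis"
  then have ends_above: "0 < height k (vertex m)" "0 < height k (vertex (Suc m))"
    using assms(1,2) by (auto intro!: height_vertex_pos)
  obtain x where meeting_point: "x \<in> side k" "x \<in> side m"
    using meeting by blast
  then obtain r where r_unit: "r \<in> {0..1}"
    and convex_combination: "x = (1 - r) *\<^sub>R vertex m + r *\<^sub>R vertex (Suc m)"
    by (auto simp: side_def in_segment)
  have "height k x = (1 - r) * height k (vertex m) + r * height k (vertex (Suc m))"
    unfolding convex_combination by (simp add: height_def algebra_simps)
  also have "\<dots> > 0"
    using ends_above r_unit by (cases "r = 0") (auto intro: add_nonneg_pos)
  finally show False
    using height_side[OF meeting_point(1)] by simp
qed

end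

subsection \<open>Tilings of zonogons have three filled corners\<close>

definition shares_boundary_path :: "'a::euclidean_space set \<Rightarrow> 'a set \<Rightarrow> bool" where
  "shares_boundary_path B R \<longleftrightarrow>
    (\<exists>E F. E edge_of R \<and> F edge_of R \<and> E \<noteq> F \<and> E \<inter> F \<noteq> {} \<and> E \<subseteq> B \<and> F \<subseteq> B)"

lemma card_tight_steps_ge_3:
  fixes c :: "nat \<Rightarrow> nat"
  assumes upper: "\<And>k. c k < k + n"
    and steps: "\<And>k. c (Suc k) \<le> c k \<or> c k = Suc k"
    and period: "c (2 * n) = c 0 + 2 * n"
  shows "3 \<le> card {k. k < 2 * n \<and> c k = Suc k}"
proof -
  let ?E = "{k. k < 2 * n \<and> c k = Suc k}"
  have "0 < n"
    using upper[of 0] by simp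
  have "int (2 * n) = int (c (2 * n)) - int (c 0)"
    using period by simp
  also have "\<dots> = (\<Sum>k<2 * n. int (c (Suc k)) - int (c k))"
    by (rule sum_lessThan_telescope[symmetric])
  also have "\<dots> \<le> (\<Sum>k<2 * n. if c k = Suc k then int n - 1 else 0)"
  proof (rule sum_mono)
    fix k assume "k \<in> {..<2 * n}"
    then show "int (c (Suc k)) - int (c k) \<le> (if c k = Suc k then int n - 1 else 0)"
      using steps[of k] upper[of "Suc k"] by auto
  qed
  also have "\<dots> = int (card ?E) * (int n - 1)"
    by (simp add: sum.If_cases Int_def)
  finally have total_increase: "int (2 * n) \<le> int (card ?E) * (int n - 1)" .
  show ?thesis
  proof (rule ccontr)
    assume "\<not> ?thesis"
    then have "int (card ?E) * (int n - 1) \<le> 2 * (int n - 1)"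
      using \<open>0 < n\<close> by (intro mult_right_mono) auto
    with total_increase show False
      by simp
  qed
qed

context zonogon
begin

definition tile :: "complex set \<Rightarrow> bool" where
  "tile R \<longleftrightarrow> (\<exists>p. \<exists>a\<in>range dir. \<exists>b\<in>range dir. det2 a b \<noteq> 0 \<and> R = parallelogram p a b)"

definition tilings :: "complex set set set" where
  "tilings = {T. finite T \<and> (\<forall>R\<in>T. tile R) \<and>
     (\<forall>R\<in>T. \<forall>S\<in>T. R \<noteq> S \<longrightarrow> interior R \<inter> interior S = {}) \<and> \<Union>T = polygon}"

definition side_tile :: "nat \<Rightarrow> nat \<Rightarrow> complex set" where
  "side_tile k c = parallelogram (vertex k) (dir k) (dir c)"

definition corner_tile :: "nat \<Rightarrow> complex set" where
  "corner_tile k = side_tile k (Suc k)"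

definition filled_corners :: "complex set set \<Rightarrow> nat set" where
  "filled_corners T = {k. k < 2 * n \<and> corner_tile k \<in> T}"

lemma eq_vertex_if_edge_on_side:
  assumes "q \<in> polygon" "q + dir k \<in> polygon" "height k q = 0"
  shows "q = vertex k"
proof -
  have "q \<in> side k" "q + dir k \<in> side k"
    using assms by (auto intro!: side_if_height_zero simp: height_def)
  then obtain r r' where unit: "r \<in> {0..1}" "r' \<in> {0..1}"
    and on_side: "q = vertex k + r *\<^sub>R dir k" "q + dir k = vertex k + r' *\<^sub>R dir k"
    unfolding mem_side by blast
  have "(1 + r - r') *\<^sub>R dir k = 0"
    using on_side by (simp add: algebra_simps)
  then show ?thesis
    using unit on_side(1) by auto
qed

lemma tile_touching_side:
  assumes tile_in_polygon: "tile R" "R \<subseteq> polygon" and touching: "infinite (R \<inter> side k)"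
  obtains c where "k < c" "c < k + n" "R = side_tile k c"
proof -
  obtain p a b where spanned: "a \<in> range dir" "b \<in> range dir" "det2 a b \<noteq> 0"
    and R_eq: "R = parallelogram p a b"
    using tile_in_polygon(1) unfolding tile_def by blast
  have "\<not> R \<inter> side k \<subseteq> {p, p + a, p + b, p + a + b}"
    using touching finite_subset by blast
  then obtain x where touching_point: "x \<in> R" "x \<in> side k" "x \<notin> {p, p + a, p + b, p + a + b}"
    by blast
  obtain q a' b' where "{a', b'} \<subseteq> {a, - a, b, - b}" and R_on_line: "R = parallelogram q a' b'"
    and on_line: "height k q = 0" "det2 (dir k) a' = 0" and above_line: "0 < det2 (dir k) b'"
  proof (rule parallelogram_touching_line[OF spanned(3) dir_nonzero[of k]])
    show "0 \<le> det2 (dir k) (z - vertex k)" if "z \<in> parallelogram p a b" for z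
      using that tile_in_polygon(2) R_eq height_nonneg[of z k] by (auto simp: height_def)
    show "x \<in> parallelogram p a b" "x \<notin> {p, p + a, p + b, p + a + b}"
      "det2 (dir k) (x - vertex k) = 0"
      using touching_point height_side[OF touching_point(2)] by (auto simp: R_eq height_def)
  qed (simp add: R_eq height_def)
  then have in_range: "a' \<in> range dir" "b' \<in> range dir"
    using spanned(1,2) by auto
  obtain q' where R_oriented: "R = parallelogram q' (dir k) b'" "height k q' = 0"
  proof (cases "a' = dir k")
    case False
    then have "dir k = - a'"
      using dir_parallel[OF in_range(1) on_line(2)] by auto
    then show thesis
      using that[of "q + a'"] on_line by (simp add: R_on_line parallelogram_flip[of q] height_def)
  qed (use that on_line(1) R_on_line in blast)
  have "q' = vertex k"
    using tile_in_polygon(2) R_oriented corners_in_parallelogram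
    by (intro eq_vertex_if_edge_on_side) auto
  moreover obtain c where "k < c" "c < k + n" "b' = dir c"
    using dir_left_of[OF in_range(2) above_line] .
  ultimately show thesis
    using that R_oriented(1) by (auto simp: side_tile_def)
qed

lemma exists_side_tile:
  assumes "T \<in> tilings"
  obtains c where "k < c" "c < k + n" "side_tile k c \<in> T"
proof -
  have "finite T" and tiles: "\<And>R. R \<in> T \<Longrightarrow> tile R \<and> R \<subseteq> polygon" and union: "\<Union>T = polygon"
    using assms by (auto simp: tilings_def)
  have "side k = (\<Union>R\<in>T. R \<inter> side k)"
    using side_subset_polygon[of k] union by blast
  then have "infinite (\<Union>R\<in>T. R \<inter> side k)"
    using infinite_side[of k] by simp
  then obtain R where "R \<in> T" "infinite (R \<inter> side k)"
    unfolding finite_UN[OF \<open>finite T\<close>] by blast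
  with tiles[of R] show thesis
    using that tile_touching_side by metis
qed

lemma side_tile_at_next_vertex:
  "side_tile k c = parallelogram (vertex (Suc k)) (dir c) (dir (k + n))"
  unfolding side_tile_def parallelogram_flip[of "vertex k"] vertex_Suc dir_add_n
  by (rule parallelogram_swap)

lemma side_tile_edge: "k < c \<Longrightarrow> c < k + n \<Longrightarrow> side k edge_of side_tile k c"
  unfolding side_tile_def side_def vertex_Suc
  by (intro closed_segment_edge_of_parallelogram det2_dir_pos)

lemma side_tile_is_corner_tile:
  assumes "k < c" "c < k + n" and next_vertex: "vertex (Suc (Suc k)) \<in> side_tile k c"
  shows "c = Suc k" "side_tile k c = corner_tile k"
proof -
  have "0 < det2 (dir c) (dir (k + n))"
    using assms(1,2) by (intro det2_dir_pos) auto
  then have "0 \<le> det2 (dir c) (dir (Suc k))"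
    using next_vertex unfolding side_tile_at_next_vertex
    by (simp add: mem_parallelogram_iff_det2 vertex_Suc[of "Suc k"])
  then have "\<not> Suc k < c"
    using det2_dir_pos[of "Suc k" c] det2_commute[of "dir c" "dir (Suc k)"] assms(2) by auto
  then show "c = Suc k"
    using assms(1) by simp
  then show "side_tile k c = corner_tile k"
    by (simp add: corner_tile_def)
qed

lemma consecutive_side_tiles:
  assumes tiling: "T \<in> tilings"
    and tile_at_k: "k < c" "c < k + n" "side_tile k c \<in> T"
    and tile_at_Suc_k: "Suc k < c'" "c' < Suc k + n" "side_tile (Suc k) c' \<in> T"
  shows "c' \<le> c \<or> c = Suc k"
proof (rule ccontr)
  assume "\<not> ?thesis"
  then have less: "c < c'" "Suc k < c"
    using tile_at_k by auto
  have "interior (side_tile k c) \<inter> interior (side_tile (Suc k) c') \<noteq> {}"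
    unfolding side_tile_at_next_vertex[of k] side_tile_def[of "Suc k"]
  proof (rule interior_parallelograms_overlap)
    show "0 < det2 (dir c) (dir (k + n))" "0 < det2 (dir (Suc k)) (dir c')"
      "0 < det2 (dir c) (dir c')"
      using tile_at_k tile_at_Suc_k less by (auto intro!: det2_dir_pos simp del: dir_add_n)
    show "0 \<le> det2 (dir (Suc k)) (dir c)" "0 \<le> det2 (dir c') (dir (k + n))"
      using tile_at_k tile_at_Suc_k less by (auto intro!: det2_dir_nonneg simp del: dir_add_n)
  qed
  then have "side_tile k c = side_tile (Suc k) c'"
    using tiling tile_at_k(3) tile_at_Suc_k(3) by (auto simp: tilings_def)
  moreover have "vertex (Suc (Suc k)) \<in> side_tile (Suc k) c'"
    by (simp add: side_tile_def vertex_Suc[of "Suc k"] corners_in_parallelogram)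
  ultimately have "c = Suc k"
    using side_tile_is_corner_tile(1)[OF tile_at_k(1,2)] by simp
  with less show False
    by simp
qed

lemma card_filled_corners_ge_3:
  assumes tiling: "T \<in> tilings"
  shows "3 \<le> card (filled_corners T)"
proof -
  have "\<forall>k. \<exists>c. k < c \<and> c < k + n \<and> side_tile k c \<in> T"
    using exists_side_tile[OF tiling] by metis
  then obtain g where tile_index: "\<And>k. k < g k \<and> g k < k + n \<and> side_tile k (g k) \<in> T"
    by metis
  define c where "c k = g (k mod (2 * n)) + k div (2 * n) * (2 * n)" for k
  have side_tile_c: "k < c k" "c k < k + n" "side_tile k (c k) \<in> T" for k
  proof -
    let ?r = "k mod (2 * n)" and ?q = "k div (2 * n) * (2 * n)"
    have k_eq: "k = ?r + ?q"
      by (rule mod_div_mult_eq[symmetric])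
    have "dir (c k) = dir (g ?r)"
      using periodic_mod[of dir "2 * n" "c k"] periodic_mod[of dir "2 * n" "g ?r"]
      by (simp add: c_def)
    moreover have "vertex ?r = vertex k" "dir ?r = dir k"
      by (simp_all add: periodic_mod[of vertex] periodic_mod[of dir])
    ultimately show "side_tile k (c k) \<in> T"
      using tile_index[of ?r] by (simp add: side_tile_def)
    show "k < c k" "c k < k + n"
      using tile_index[of ?r] k_eq unfolding c_def by linarith+
  qed
  have "3 \<le> card {k. k < 2 * n \<and> c k = Suc k}"
  proof (rule card_tight_steps_ge_3)
    show "c (2 * n) = c 0 + 2 * n"
      using n_gt_1 by (simp add: c_def)
  qed (use side_tile_c consecutive_side_tiles[OF tiling side_tile_c side_tile_c] in auto)
  also have "\<dots> \<le> card (filled_corners T)"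
    using side_tile_c(3)
    by (intro card_mono) (auto simp: filled_corners_def corner_tile_def dest: sym)
  finally show ?thesis .
qed

lemma boundary_edge_eq_side:
  assumes tile_in_polygon: "tile R" "R \<subseteq> polygon" and edge: "E edge_of R" "E \<subseteq> frontier polygon"
  obtains k c where "k < 2 * n" "k < c" "c < k + n" "R = side_tile k c" "E = side k"
proof -
  have "E = (\<Union>k<2 * n. E \<inter> side k)"
    using edge(2) unfolding frontier_polygon by blast
  then have "infinite (\<Union>k<2 * n. E \<inter> side k)"
    using infinite_edge[OF edge(1)] by simp
  then obtain k where infinite_side_part: "k < 2 * n" "infinite (E \<inter> side k)"
    unfolding finite_UN[OF finite_lessThan] by blast
  then have "infinite (R \<inter> side k)"
    using edge_of_imp_subset[OF edge(1)] by (meson Int_mono finite_subset order_refl)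
  then obtain c where tile_at_side: "k < c" "c < k + n" "R = side_tile k c"
    using tile_touching_side[OF tile_in_polygon] by blast
  moreover have "E = side k"
    using edge(1) infinite_side_part(2) side_tile_edge[OF tile_at_side(1,2)] tile_at_side(3)
      edges_eq_if_infinite_Int by metis
  ultimately show thesis
    using that infinite_side_part(1) by blast
qed

lemma corner_tile_shares_boundary_path: "shares_boundary_path (frontier polygon) (corner_tile k)"
  unfolding shares_boundary_path_def
proof (rule exI[of _ "side k"], rule exI[of _ "side (Suc k)"], intro conjI)
  have "0 < det2 (dir (Suc k)) (dir (k + n))"
    using n_gt_1 by (intro det2_dir_pos) auto
  then show "side (Suc k) edge_of corner_tile k"
    unfolding corner_tile_def side_tile_at_next_vertex side_def vertex_Suc[of "Suc k"]
    by (rule closed_segment_edge_of_parallelogram)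
  show "side k edge_of corner_tile k"
    unfolding corner_tile_def using n_gt_1 by (intro side_tile_edge) auto
  have "height k (vertex (Suc (Suc k))) > 0"
    using n_gt_1 by (intro height_vertex_pos) auto
  then have "vertex (Suc (Suc k)) \<notin> side k"
    using height_side by force
  moreover have "vertex (Suc (Suc k)) \<in> side (Suc k)" "vertex (Suc k) \<in> side k \<inter> side (Suc k)"
    by (simp_all add: side_def)
  ultimately show "side k \<noteq> side (Suc k)" "side k \<inter> side (Suc k) \<noteq> {}"
    by blast+
qed (rule side_subset_frontier)+

lemma shares_boundary_path_iff_corner_tile:
  assumes tile_in_polygon: "tile R" "R \<subseteq> polygon"
  shows "shares_boundary_path (frontier polygon) R \<longleftrightarrow> R \<in> corner_tile ` {..<2 * n}"
proof
  assume "shares_boundary_path (frontier polygon) R"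
  then obtain E F where distinct_meeting: "E \<noteq> F" "E \<inter> F \<noteq> {}"
    and "E edge_of R" "E \<subseteq> frontier polygon" "F edge_of R" "F \<subseteq> frontier polygon"
    unfolding shares_boundary_path_def by blast
  obtain k c where tile_at_k: "k < 2 * n" "k < c" "c < k + n" "R = side_tile k c" "E = side k"
    using boundary_edge_eq_side[OF tile_in_polygon \<open>E edge_of R\<close> \<open>E \<subseteq> frontier polygon\<close>] .
  obtain m d where tile_at_m: "m < 2 * n" "m < d" "d < m + n" "R = side_tile m d" "F = side m"
    using boundary_edge_eq_side[OF tile_in_polygon \<open>F edge_of R\<close> \<open>F \<subseteq> frontier polygon\<close>] .
  have ends: "vertex (Suc k) \<in> R" "vertex (Suc m) \<in> R"
    using edge_of_imp_subset \<open>E edge_of R\<close> \<open>F edge_of R\<close> tile_at_k(5) tile_at_m(5)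
    by (auto simp: side_def)
  have next_corner: "R = corner_tile i"
    if "i < e" "e < i + n" "R = side_tile i e" "vertex (Suc (Suc i)) \<in> R" for i e
    using that side_tile_is_corner_tile(2)[of i e] by simp
  have "m = Suc k \<or> k = Suc m \<or> k + 2 * n = Suc m \<or> m + 2 * n = Suc k"
  proof (cases k m rule: linorder_cases)
    case less
    then show ?thesis
      using sides_meet_imp_consecutive[of k m] distinct_meeting tile_at_k tile_at_m by auto
  next
    case greater
    then show ?thesis
      using sides_meet_imp_consecutive[of m k] distinct_meeting tile_at_k tile_at_m by auto
  qed (use distinct_meeting tile_at_k tile_at_m in simp)
  then have "vertex (Suc (Suc k)) \<in> R \<or> vertex (Suc (Suc m)) \<in> R"
    using ends vertex_add_2n[of "Suc k"] vertex_add_2n[of "Suc m"] by (metis add_Suc)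
  then show "R \<in> corner_tile ` {..<2 * n}"
    using next_corner[OF tile_at_k(2-4)] next_corner[OF tile_at_m(2-4)] tile_at_k(1) tile_at_m(1)
    by blast
qed (use corner_tile_shares_boundary_path in blast)

lemma vertices_in_corner_tile:
  "vertex k \<in> corner_tile k" "vertex (Suc k) \<in> corner_tile k" "vertex (Suc (Suc k)) \<in> corner_tile k"
  using corners_in_parallelogram[where p = "vertex k" and a = "dir k" and b = "dir (Suc k)"]
  by (simp_all add: corner_tile_def side_tile_def vertex_Suc)

lemma vertex_notin_corner_tile:
  assumes "2 < n" "k + 3 \<le> j" "j \<le> k + n + 1"
  shows "vertex j \<notin> corner_tile k"
proof
  assume "vertex j \<in> corner_tile k"
  moreover have "0 < det2 (dir k) (dir (Suc k))"
    using n_gt_1 by (intro det2_dir_pos) auto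
  ultimately have "height k (vertex j) \<le> height k (vertex (k + 2))"
    by (simp add: corner_tile_def side_tile_def mem_parallelogram_iff_det2 height_def vertex_Suc)
  moreover have "0 < (\<Sum>l\<in>{k + 2..<j}. det2 (dir k) (dir l))"
  proof (rule sum_pos2)
    show "0 < det2 (dir k) (dir (k + 2))"
      using assms(1) by (intro det2_dir_pos) auto
  qed (use assms in \<open>auto intro!: det2_dir_nonneg\<close>)
  ultimately show False
    using height_vertex_diff[of "k + 2" j k] assms(2) by simp
qed

lemma corner_tile_add_2n: "corner_tile (k + 2 * n) = corner_tile k"
  using dir_add_2n[of "Suc k"] by (simp add: corner_tile_def side_tile_def)

lemma inj_on_corner_tile:
  assumes "2 < n"
  shows "inj_on corner_tile {..<2 * n}"
proof (rule linorder_inj_onI)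
  fix k m assume "k < m" "k \<in> {..<2 * n}" "m \<in> {..<2 * n}"
  then consider (near) "m < k + n" | (opposite) "m = k + n" | (far) "k + n < m" "m < k + 2 * n"
    by force
  then show "corner_tile k \<noteq> corner_tile m"
  proof cases
    case near
    with \<open>k < m\<close> show ?thesis
      using vertex_notin_corner_tile[OF assms, of k "m + 2"] vertices_in_corner_tile(3)[of m]
      by auto
  next
    case opposite
    then show ?thesis
      using vertex_notin_corner_tile[OF assms, of k m] vertices_in_corner_tile(1)[of m] assms
      by auto
  next
    case far
    then show ?thesis
      using vertex_notin_corner_tile[OF assms, of m "k + 2 * n + 2"]
        vertices_in_corner_tile(3)[of "k + 2 * n"] corner_tile_add_2n[of k] by auto
  qed
qed auto

lemma card_shares_boundary_path:
  assumes "2 < n" "T \<in> tilings"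
  shows "card {R \<in> T. shares_boundary_path (frontier polygon) R} = card (filled_corners T)"
proof -
  have "shares_boundary_path (frontier polygon) R \<longleftrightarrow> R \<in> corner_tile ` {..<2 * n}" if "R \<in> T" for R
    using assms(2) that by (intro shares_boundary_path_iff_corner_tile) (auto simp: tilings_def)
  then have "{R \<in> T. shares_boundary_path (frontier polygon) R} = corner_tile ` filled_corners T"
    by (auto simp: filled_corners_def)
  moreover have "inj_on corner_tile (filled_corners T)"
    by (rule inj_on_subset[OF inj_on_corner_tile[OF assms(1)]]) (auto simp: filled_corners_def)
  ultimately show ?thesis
    by (simp add: card_image)
qed

end

subsection \<open>A tiling with three filled corners\<close>

lemma sum_scaleR_fun_upd:
  fixes g :: "'i \<Rightarrow> 'a::real_vector"
  assumes "finite I" "i \<in> I"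
  shows "(\<Sum>l\<in>I. (s(i := r)) l *\<^sub>R g l) = (\<Sum>l\<in>I. s l *\<^sub>R g l) + (r - s i) *\<^sub>R g i"
  using assms by (simp add: sum.remove[of I i] algebra_simps)

lemma support_interval_saturated:
  fixes s :: "nat \<Rightarrow> real"
  assumes "1 < n" and unit: "s \<in> {..<n} \<rightarrow> {0..1}"
    and saturated: "\<And>i j k. i < j \<Longrightarrow> j < k \<Longrightarrow> k < n \<Longrightarrow> 0 < s i \<Longrightarrow> 0 < s k \<Longrightarrow> s j = 1"
  obtains i j where "i < j" "j < n"
    "\<And>l. l < n \<Longrightarrow> l \<noteq> i \<Longrightarrow> l \<noteq> j \<Longrightarrow> s l = of_bool (i < l \<and> l < j)"
proof -
  define covers where
    "covers i j \<longleftrightarrow> i < j \<and> j < n \<and> (\<forall>l<n. l < i \<or> j < l \<longrightarrow> s l = 0)" for i j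
  have "covers 0 (n - 1)"
    using \<open>1 < n\<close> by (auto simp: covers_def)
  then obtain i j where shortest: "covers i j" "\<And>i' j'. covers i' j' \<Longrightarrow> j - i \<le> j' - i'"
    using ex_has_least_nat[of "\<lambda>(i, j). covers i j" "(0, n - 1)" "\<lambda>(i, j). j - i"] by auto
  have "s l = 1" if "i < l" "l < j" for l
  proof (rule saturated[OF that])
    obtain j' where j_eq: "j = Suc j'"
      using \<open>l < j\<close> by (cases j) auto
    have "\<not> covers (Suc i) j" "\<not> covers i j'"
      using shortest(2)[of "Suc i" j] shortest(2)[of i j'] that j_eq by auto
    then have "s i \<noteq> 0" "s j \<noteq> 0"
      using shortest(1) that j_eq by (auto simp: covers_def less_Suc_eq dest: Suc_lessI)
    then show "0 < s i" "0 < s j"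
      using Pi_mem[OF unit, of i] Pi_mem[OF unit, of j] shortest(1) by (auto simp: covers_def)
  qed (use shortest(1) in \<open>simp add: covers_def\<close>)
  with shortest(1) show thesis
    by (intro that[of i j]) (auto simp: covers_def)
qed

context zonogon
begin

abbreviation combination :: "(nat \<Rightarrow> real) \<Rightarrow> complex" where
  "combination u \<equiv> (\<Sum>l<n. u l *\<^sub>R dir l)"

abbreviation cost :: "(nat \<Rightarrow> real) \<Rightarrow> real" where
  "cost u \<equiv> (\<Sum>l<n. u l * norm (dir l))"

text \<open>A coherent tiling in the sense of Billera and Sturmfels: its tiles are the projections of the
  lower facets of the zonotope spanned by the lifted vectors \<open>(dir l, norm (dir l))\<close>.\<close>

definition coherent_tile :: "nat \<Rightarrow> nat \<Rightarrow> complex set" where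
  "coherent_tile i j = parallelogram (\<Sum>l\<in>{i<..<j}. dir l) (dir i) (dir j)"

definition coherent_tiling :: "complex set set" where
  "coherent_tiling = {coherent_tile i j | i j. i < j \<and> j < n}"

definition coherent_coeffs :: "nat \<Rightarrow> nat \<Rightarrow> (nat \<Rightarrow> real) set" where
  "coherent_coeffs i j =
    {u \<in> {..<n} \<rightarrow> {0..1}. \<forall>l<n. l \<noteq> i \<longrightarrow> l \<noteq> j \<longrightarrow> u l = of_bool (i < l \<and> l < j)}"

lemma combination_coherent_coeffs:
  assumes indices: "i < j" "j < n" and coherent: "u \<in> coherent_coeffs i j"
  shows "combination u = (\<Sum>l\<in>{i<..<j}. dir l) + u i *\<^sub>R dir i + u j *\<^sub>R dir j"
proof -
  have "combination u = (\<Sum>l\<in>insert i (insert j {i<..<j}). u l *\<^sub>R dir l)"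
    using indices coherent by (intro sum.mono_neutral_right) (auto simp: coherent_coeffs_def)
  also have "\<dots> = u i *\<^sub>R dir i + (u j *\<^sub>R dir j + (\<Sum>l\<in>{i<..<j}. u l *\<^sub>R dir l))"
    using indices by simp
  also have "(\<Sum>l\<in>{i<..<j}. u l *\<^sub>R dir l) = (\<Sum>l\<in>{i<..<j}. dir l)"
    using indices coherent by (intro sum.cong) (auto simp: coherent_coeffs_def)
  finally show ?thesis
    by (simp add: algebra_simps)
qed

lemma coherent_tile_eq:
  assumes indices: "i < j" "j < n"
  shows "coherent_tile i j = combination ` coherent_coeffs i j"
proof (intro equalityI subsetI)
  fix x assume "x \<in> coherent_tile i j"
  then obtain s t where coefficients: "s \<in> {0..1}" "t \<in> {0..1}"
    and x_eq: "x = (\<Sum>l\<in>{i<..<j}. dir l) + s *\<^sub>R dir i + t *\<^sub>R dir j"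
    unfolding coherent_tile_def mem_parallelogram by blast
  define u where "u = (\<lambda>l. of_bool (i < l \<and> l < j))(i := s, j := t)"
  have coherent: "u \<in> coherent_coeffs i j" "u i = s" "u j = t"
    using indices coefficients by (auto simp: u_def coherent_coeffs_def)
  then show "x \<in> combination ` coherent_coeffs i j"
    using x_eq combination_coherent_coeffs[OF indices coherent(1)]
    by (intro image_eqI[of _ _ u]) auto
next
  fix x assume "x \<in> combination ` coherent_coeffs i j"
  then obtain u where coherent: "u \<in> coherent_coeffs i j" and x_eq: "x = combination u"
    by blast
  have "u i \<in> {0..1}" "u j \<in> {0..1}"
    using coherent indices by (auto simp: coherent_coeffs_def Pi_iff)
  then show "x \<in> coherent_tile i j"
    unfolding coherent_tile_def mem_parallelogram x_eq
      combination_coherent_coeffs[OF indices coherent]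
    by blast
qed

lemma combination_in_interior_coherent_tile:
  assumes indices: "i < j" "j < n" and coherent: "u \<in> coherent_coeffs i j"
    and interior: "combination u \<in> interior (coherent_tile i j)"
  shows "u i \<in> {0<..<1}" "u j \<in> {0<..<1}"
proof -
  let ?d = "det2 (dir i) (dir j)"
  have det2_pos: "0 < ?d"
    using indices by (intro det2_dir_pos) auto
  have "0 < u j * ?d" "u j * ?d < 1 * ?d" "0 < u i * ?d" "u i * ?d < 1 * ?d"
    using interior unfolding coherent_tile_def interior_parallelogram[OF det2_pos]
      combination_coherent_coeffs[OF indices coherent] by auto
  then show "u i \<in> {0<..<1}" "u j \<in> {0<..<1}"
    using det2_pos by (auto simp: zero_less_mult_iff mult_less_cancel_right)
qed

lemma norm_dir_less:
  assumes "i < j" "j < k" "k < i + n"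
  shows "norm (dir j) * det2 (dir i) (dir k)
    < norm (dir i) * det2 (dir j) (dir k) + norm (dir k) * det2 (dir i) (dir j)"
proof -
  define x where "x = det2 (dir j) (dir k) *\<^sub>R dir i"
  define y where "y = det2 (dir i) (dir j) *\<^sub>R dir k"
  have det2_pos: "0 < det2 (dir i) (dir j)" "0 < det2 (dir j) (dir k)" "0 < det2 (dir i) (dir k)"
    using assms by (auto intro!: det2_dir_pos)
  have "norm x *\<^sub>R y \<noteq> norm y *\<^sub>R x"
  proof
    assume "norm x *\<^sub>R y = norm y *\<^sub>R x"
    then have "det2 (dir i) (norm x *\<^sub>R y) = det2 (dir i) (norm y *\<^sub>R x)"
      by simp
    with det2_pos show False
      by (simp add: x_def y_def)
  qed
  then have "norm (x + y) < norm x + norm y"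
    using norm_triangle_ineq[of x y] norm_triangle_eq[of x y] by linarith
  moreover have "x + y = det2 (dir i) (dir k) *\<^sub>R dir j"
    by (simp add: x_def y_def det2_cramer[of "dir i" "dir k" "dir j"])
  ultimately show ?thesis
    using det2_pos by (simp add: x_def y_def mult.commute)
qed

text \<open>The norm minus the linear functional that agrees with it at \<open>dir i\<close> and \<open>dir j\<close>, multiplied by
  \<open>det2 (dir i) (dir j)\<close>.\<close>

definition reduced_cost :: "nat \<Rightarrow> nat \<Rightarrow> nat \<Rightarrow> real" where
  "reduced_cost i j l = norm (dir l) * det2 (dir i) (dir j)
    - norm (dir i) * det2 (dir l) (dir j) - norm (dir j) * det2 (dir i) (dir l)"

lemma reduced_cost_eq_0 [simp]: "reduced_cost i j i = 0" "reduced_cost i j j = 0"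
  by (simp_all add: reduced_cost_def)

lemma reduced_cost_neg:
  assumes "i < l" "l < j" "j < n"
  shows "reduced_cost i j l < 0"
  using norm_dir_less[of i l j] assms by (simp add: reduced_cost_def)

lemma reduced_cost_pos:
  assumes "i < j" "j < n" "l < n" "l < i \<or> j < l"
  shows "0 < reduced_cost i j l"
  using assms(4)
proof
  assume "l < i"
  with assms show ?thesis
    using norm_dir_less[of l i j] det2_commute[of "dir i" "dir l"] by (simp add: reduced_cost_def)
next
  assume "j < l"
  with assms show ?thesis
    using norm_dir_less[of i j l] det2_commute[of "dir j" "dir l"] by (simp add: reduced_cost_def)
qed

lemma sum_reduced_cost:
  "(\<Sum>l<n. d l * reduced_cost i j l) = cost d * det2 (dir i) (dir j)
    - norm (dir i) * det2 (combination d) (dir j) - norm (dir j) * det2 (dir i) (combination d)"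
  by (simp add: reduced_cost_def right_diff_distrib sum_subtractf det2.sum_left det2.sum_right
      sum_distrib_left sum_distrib_right mult.assoc mult.commute mult.left_commute)

lemma coherent_coeffs_slackness:
  assumes indices: "i < j" "j < n" and coherent: "u \<in> coherent_coeffs i j"
    and "l < n" and unit: "r \<in> {0..1}"
  shows "0 \<le> (r - u l) * reduced_cost i j l"
    and "(r - u l) * reduced_cost i j l = 0 \<Longrightarrow> l \<noteq> i \<Longrightarrow> l \<noteq> j \<Longrightarrow> r = u l"
proof -
  consider (spanning) "l = i \<or> l = j" | (between) "i < l" "l < j" | (outside) "l < i \<or> j < l"
    by linarith
  then have "0 \<le> (r - u l) * reduced_cost i j l
    \<and> ((r - u l) * reduced_cost i j l = 0 \<longrightarrow> l \<noteq> i \<longrightarrow> l \<noteq> j \<longrightarrow> r = u l)"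
  proof cases
    case between
    then have "u l = 1" "reduced_cost i j l < 0"
      using coherent \<open>l < n\<close> indices(2) by (auto simp: coherent_coeffs_def intro: reduced_cost_neg)
    with unit show ?thesis
      by (auto intro: mult_nonpos_nonpos)
  next
    case outside
    then have "u l = 0" "0 < reduced_cost i j l"
      using coherent \<open>l < n\<close> indices by (auto simp: coherent_coeffs_def intro: reduced_cost_pos)
    with unit show ?thesis
      by auto
  qed auto
  then show "0 \<le> (r - u l) * reduced_cost i j l"
    and "(r - u l) * reduced_cost i j l = 0 \<Longrightarrow> l \<noteq> i \<Longrightarrow> l \<noteq> j \<Longrightarrow> r = u l"
    by auto
qed

lemma coherent_coeffs_unique_minimizer:
  assumes indices: "i < j" "j < n" and coherent: "u \<in> coherent_coeffs i j"
    and cheaper: "t \<in> {..<n} \<rightarrow> {0..1}" "combination t = combination u" "cost t \<le> cost u"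
    and "l < n"
  shows "t l = u l"
proof -
  define d where "d l = t l - u l" for l
  have combination_d: "combination d = 0"
    using cheaper(2) by (simp add: d_def scaleR_diff_left sum_subtractf)
  have det2_pos: "0 < det2 (dir i) (dir j)"
    using indices by (intro det2_dir_pos) auto
  have slackness: "0 \<le> d l * reduced_cost i j l"
    "d l * reduced_cost i j l = 0 \<Longrightarrow> l \<noteq> i \<Longrightarrow> l \<noteq> j \<Longrightarrow> d l = 0" if "l < n" for l
    using coherent_coeffs_slackness[OF indices coherent that, of "t l"]
      Pi_mem[OF cheaper(1), of l] that
    by (auto simp: d_def)
  have "cost d \<le> 0"
    using cheaper(3) by (simp add: d_def left_diff_distrib sum_subtractf)
  then have "(\<Sum>l<n. d l * reduced_cost i j l) \<le> 0"
    unfolding sum_reduced_cost combination_d using det2_pos by (simp add: mult_nonpos_nonneg)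
  then have "(\<Sum>l<n. d l * reduced_cost i j l) = 0"
    using slackness(1) by (intro antisym sum_nonneg) auto
  then have "d l * reduced_cost i j l = 0" if "l < n" for l
    using that slackness(1) by (subst (asm) sum_nonneg_eq_0_iff) auto
  then have d_other: "d l = 0" if "l < n" "l \<noteq> i" "l \<noteq> j" for l
    using slackness(2) that by blast
  have "combination d = (\<Sum>l\<in>{i, j}. d l *\<^sub>R dir l)"
    using indices d_other by (intro sum.mono_neutral_right) auto
  then have dependence: "d i *\<^sub>R dir i + d j *\<^sub>R dir j = 0"
    using indices combination_d by simp
  have "d i = 0" "d j = 0"
    using arg_cong[OF dependence, of "\<lambda>z. det2 z (dir j)"]
      arg_cong[OF dependence, of "det2 (dir i)"] det2_pos by auto
  with d_other[of l] \<open>l < n\<close> show ?thesis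
    by (cases "l = i \<or> l = j") (auto simp: d_def)
qed

lemma coherent_coeffs_fractional:
  assumes coherent: "u \<in> coherent_coeffs i j" and "l < n" and fractional: "u l \<in> {0<..<1}"
  shows "l = i \<or> l = j"
proof (rule ccontr)
  assume "\<not> ?thesis"
  then have "u l = of_bool (i < l \<and> l < j)"
    using coherent \<open>l < n\<close> by (simp add: coherent_coeffs_def)
  with fractional show False
    by (simp add: of_bool_def split: if_splits)
qed

lemma interior_coherent_tile_disjoint:
  assumes indices: "i < j" "j < n" and indices': "i' < j'" "j' < n"
    and common_point: "x \<in> interior (coherent_tile i j)" "x \<in> coherent_tile i' j'"
  shows "i = i' \<and> j = j'"
proof -
  have "x \<in> coherent_tile i j"
    using common_point(1) interior_subset by blast
  then obtain u where coherent: "u \<in> coherent_coeffs i j" "x = combination u"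
    unfolding coherent_tile_eq[OF indices] by blast
  obtain u' where coherent': "u' \<in> coherent_coeffs i' j'" "x = combination u'"
    using common_point(2) unfolding coherent_tile_eq[OF indices'] by blast
  have unit: "u \<in> {..<n} \<rightarrow> {0..1}" "u' \<in> {..<n} \<rightarrow> {0..1}"
    using coherent(1) coherent'(1) by (auto simp: coherent_coeffs_def)
  have combinations_eq: "combination u = combination u'"
    using coherent(2) coherent'(2) by simp
  have coefficients_eq: "u l = u' l" if "l < n" for l
  proof (cases "cost u \<le> cost u'")
    case True
    show ?thesis
      using coherent_coeffs_unique_minimizer[OF indices' coherent'(1) unit(1) combinations_eq True]
        that .
  next
    case False
    then have "cost u' \<le> cost u"
      by simp
    then show ?thesis
      using coherent_coeffs_unique_minimizer[OF indices coherent(1) unit(2)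
          combinations_eq[symmetric]] that by simp
  qed
  have "u' i \<in> {0<..<1}" "u' j \<in> {0<..<1}"
    using combination_in_interior_coherent_tile[OF indices coherent(1)] common_point(1) coherent(2)
      coefficients_eq indices by auto
  then have "i = i' \<or> i = j'" "j = i' \<or> j = j'"
    using coherent_coeffs_fractional[OF coherent'(1)] indices by simp_all
  with indices indices' show ?thesis
    by auto
qed

text \<open>Trade \<open>dir i\<close> and \<open>dir k\<close> for the intermediate \<open>dir j\<close> in the proportions of Cramer's rule.\<close>

lemma exists_cheaper_combination:
  assumes unit: "s \<in> {..<n} \<rightarrow> {0..1}" and indices: "i < j" "j < k" "k < n"
    and slack: "0 < s i" "s j < 1" "0 < s k"
  obtains t where "t \<in> {..<n} \<rightarrow> {0..1}" "combination t = combination s" "cost t < cost s"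
proof
  define a where "a = det2 (dir j) (dir k)"
  define b where "b = det2 (dir i) (dir j)"
  define c where "c = det2 (dir i) (dir k)"
  define e where "e = Min {s i / a, s k / b, (1 - s j) / c}"
  define t where "t = s(i := s i - e * a, j := s j + e * c, k := s k - e * b)"
  have det2_pos: "0 < a" "0 < b" "0 < c"
    using indices by (auto simp: a_def b_def c_def intro!: det2_dir_pos)
  then have feasible: "0 < e" "e * a \<le> s i" "e * b \<le> s k" "e * c \<le> 1 - s j"
    using slack by (auto simp: e_def simp flip: pos_le_divide_eq)
  show "t \<in> {..<n} \<rightarrow> {0..1}"
  proof
    fix l assume "l \<in> {..<n}"
    moreover have "0 < e * a" "0 < e * b" "0 < e * c"
      using feasible(1) det2_pos by simp_all
    ultimately show "t l \<in> {0..1}"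
      using Pi_mem[OF unit, of l] feasible by (auto simp: t_def)
  qed
  have exchange: "(\<Sum>l<n. t l *\<^sub>R g l)
      = (\<Sum>l<n. s l *\<^sub>R g l) - e *\<^sub>R (a *\<^sub>R g i + b *\<^sub>R g k - c *\<^sub>R g j)"
    for g :: "nat \<Rightarrow> 'b::real_vector"
    using indices
    by (simp add: t_def sum_scaleR_fun_upd del: fun_upd_apply) (simp add: algebra_simps)
  show "combination t = combination s"
    unfolding exchange using det2_cramer[of "dir i" "dir k" "dir j"]
    by (simp add: a_def b_def c_def)
  have "cost t = cost s - e * (a * norm (dir i) + b * norm (dir k) - c * norm (dir j))"
    using exchange[of "\<lambda>l. norm (dir l)"] by simp
  also have "\<dots> < cost s"
    using norm_dir_less[of i j k] indices feasible(1) by (simp add: a_def b_def c_def mult.commute)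
  finally show "cost t < cost s" .
qed

lemma Union_coherent_tiling: "\<Union>coherent_tiling = polygon"
proof (intro equalityI subsetI)
  fix x assume "x \<in> \<Union>coherent_tiling"
  then obtain i j where indices: "i < j" "j < n" "x \<in> coherent_tile i j"
    by (auto simp: coherent_tiling_def)
  then show "x \<in> polygon"
    unfolding zonotope_eq_combinations[OF finite_lessThan] coherent_tile_eq[OF indices(1,2)]
    by (auto simp: coherent_coeffs_def)
next
  fix x assume "x \<in> polygon"
  then obtain s where s_unit: "s \<in> {..<n} \<rightarrow> {0..1}" and x_eq: "x = combination s"
    and minimal: "\<And>t. t \<in> {..<n} \<rightarrow> {0..1} \<Longrightarrow> x = combination t \<Longrightarrow> cost s \<le> cost t"
    by (rule zonotope_minimal_cost[OF finite_lessThan, where c = "\<lambda>l. norm (dir l)"]) (rule that)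
  obtain i j where indices: "i < j" "j < n"
    and "\<And>l. l < n \<Longrightarrow> l \<noteq> i \<Longrightarrow> l \<noteq> j \<Longrightarrow> s l = of_bool (i < l \<and> l < j)"
  proof (rule support_interval_saturated[OF n_gt_1 s_unit])
    show "s j = 1" if triple: "i < j" "j < k" "k < n" "0 < s i" "0 < s k" for i j k
    proof (rule ccontr)
      assume "s j \<noteq> 1"
      then have "s j < 1"
        using Pi_mem[OF s_unit, of j] triple by simp
      then obtain t where "t \<in> {..<n} \<rightarrow> {0..1}" "combination t = combination s" "cost t < cost s"
        using exists_cheaper_combination[OF s_unit triple(1-4) _ triple(5)] by blast
      with minimal[of t] x_eq show False
        by simp
    qed
  qed auto
  then have "s \<in> coherent_coeffs i j"
    using s_unit by (simp add: coherent_coeffs_def)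
  then have "x \<in> coherent_tile i j"
    unfolding coherent_tile_eq[OF indices] x_eq by blast
  with indices show "x \<in> \<Union>coherent_tiling"
    by (auto simp: coherent_tiling_def)
qed

lemma coherent_tiling_in_tilings: "coherent_tiling \<in> tilings"
  unfolding tilings_def
proof (intro CollectI conjI ballI impI)
  have "coherent_tiling \<subseteq> (\<lambda>(i, j). coherent_tile i j) ` ({..<n} \<times> {..<n})"
    by (auto simp: coherent_tiling_def)
  then show "finite coherent_tiling"
    by (rule finite_subset) auto
  show "tile R" if R_in_tiling: "R \<in> coherent_tiling" for R
  proof -
    obtain i j where indices: "i < j" "j < n" "R = coherent_tile i j"
      using R_in_tiling by (auto simp: coherent_tiling_def)
    then have "det2 (dir i) (dir j) \<noteq> 0"
      using det2_dir_pos[of i j] by simp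
    with indices(3) show ?thesis
      unfolding tile_def coherent_tile_def by blast
  qed
  show "interior R \<inter> interior S = {}" if "R \<in> coherent_tiling" "S \<in> coherent_tiling" "R \<noteq> S" for R S
  proof (rule ccontr)
    assume "interior R \<inter> interior S \<noteq> {}"
    then obtain x where "x \<in> interior R" "x \<in> S"
      using interior_subset by blast
    with that show False
      unfolding coherent_tiling_def using interior_coherent_tile_disjoint by blast
  qed
qed (rule Union_coherent_tiling)

lemma vertex_eq_combination:
  assumes "k \<le> 2 * n"
  shows "vertex k = combination (\<lambda>l. of_bool (l < k \<and> k \<le> l + n))"
proof -
  have initial: "vertex m = combination (\<lambda>l. of_bool (l < m))" if "m \<le> n" for m
    unfolding vertex_def using that by (intro sum.mono_neutral_cong_left) auto
  show ?thesis
  proof (cases "k \<le> n")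
    case True
    with initial[of k] show ?thesis
      by simp
  next
    case False
    define m where "m = k - n"
    have k_eq: "k = m + n" "m \<le> n"
      using False assms by (auto simp: m_def)
    have "vertex k = combination (\<lambda>l. of_bool (l < n) - of_bool (l < m))"
      unfolding k_eq(1) vertex_add_n scaleR_diff_left sum_subtractf using k_eq(2)
      by (simp only: initial)
    also have "\<dots> = combination (\<lambda>l. of_bool (l < k \<and> k \<le> l + n))"
      using k_eq by (intro sum.cong) auto
    finally show ?thesis .
  qed
qed

lemma combination_eq_vertex_unique:
  assumes "k \<le> 2 * n" and representation: "u \<in> {..<n} \<rightarrow> {0..1}" "combination u = vertex k"
    and "l < n"
  shows "u l = of_bool (l < k \<and> k \<le> l + n)"
proof -
  define f where "f z = det2 (dir k) z + det2 z (dir (k + n - 1))" for z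
  have f_pos: "0 < f (dir m)" if "k \<le> m" "m < k + n" for m
  proof (cases "m = k")
    case True
    with n_gt_1 show ?thesis
      by (auto simp: f_def intro!: det2_dir_pos)
  next
    case False
    with that n_gt_1 show ?thesis
      unfolding f_def by (intro add_pos_nonneg det2_dir_pos det2_dir_nonneg) auto
  qed
  define d where "d l = u l - of_bool (l < k \<and> k \<le> l + n)" for l
  have sign: "0 \<le> d l * f (dir l) \<and> (d l * f (dir l) = 0 \<longrightarrow> d l = 0)" if "l < n" for l
  proof (cases "l < k \<and> k \<le> l + n")
    case True
    then have "f (dir l) < 0"
      using f_pos[of "l + n"] by (simp add: f_def)
    with True representation(1) that show ?thesis
      by (auto simp: d_def Pi_iff intro!: mult_nonpos_nonpos)
  next
    case False
    then have "0 < f (dir l)"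
      using f_pos[of l] f_pos[of "l + 2 * n"] assms(1) that by (cases "k \<le> l") auto
    with False representation(1) that show ?thesis
      by (auto simp: d_def Pi_iff)
  qed
  have "combination d = 0"
    using representation(2) vertex_eq_combination[OF assms(1)]
    by (simp add: d_def scaleR_diff_left sum_subtractf)
  then have "f (combination d) = 0"
    by (simp add: f_def)
  then have "(\<Sum>l<n. d l * f (dir l)) = 0"
    by (simp add: f_def det2.sum_left det2.sum_right sum.distrib distrib_left)
  then have "d l * f (dir l) = 0"
    using sign \<open>l < n\<close> by (subst (asm) sum_nonneg_eq_0_iff) auto
  then show ?thesis
    using sign[OF \<open>l < n\<close>] by (simp add: d_def)
qed

lemma vertex_in_coherent_tile:
  assumes indices: "i < j" "j < n" and "vertex k \<in> coherent_tile i j" "k \<le> 2 * n"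
    and other_index: "l < n" "l \<noteq> i" "l \<noteq> j"
  shows "i < l \<and> l < j \<longleftrightarrow> l < k \<and> k \<le> l + n"
proof -
  obtain u where coherent: "u \<in> coherent_coeffs i j" "combination u = vertex k"
    using assms(3) unfolding coherent_tile_eq[OF indices] by auto
  have "of_bool (l < k \<and> k \<le> l + n) = u l"
    using combination_eq_vertex_unique[OF assms(4) _ coherent(2) other_index(1)] coherent(1)
    by (simp add: coherent_coeffs_def)
  also have "\<dots> = of_bool (i < l \<and> l < j)"
    using coherent(1) other_index by (simp add: coherent_coeffs_def)
  finally show ?thesis
    by (simp only: of_bool_eq_iff)
qed

lemma consecutive_vertices_in_coherent_tile:
  assumes indices: "i < j" "j < n" and "k < 2 * n"
    and vertices: "vertex k \<in> coherent_tile i j" "vertex (Suc k) \<in> coherent_tile i j"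
  shows "k mod n \<in> {i, j}"
proof (rule ccontr)
  define l where "l = k mod n"
  assume "k mod n \<notin> {i, j}"
  moreover have "l < n"
    using n_gt_1 by (simp add: l_def)
  ultimately have "l < k \<and> k \<le> l + n \<longleftrightarrow> l < Suc k \<and> Suc k \<le> l + n"
    using vertex_in_coherent_tile[OF indices vertices(1)]
      vertex_in_coherent_tile[OF indices vertices(2)] \<open>k < 2 * n\<close> by (auto simp: l_def)
  moreover have "k = l \<or> k = l + n"
    using \<open>k < 2 * n\<close> by (auto simp: l_def mod_if)
  ultimately show False
    using \<open>l < n\<close> by auto
qed

lemma corner_tile_eq_coherent_tile_dirs:
  assumes "k < 2 * n" and indices: "i < j" "j < n" and filled: "corner_tile k = coherent_tile i j"
  shows "k mod n \<in> {i, j}" "Suc k mod n \<in> {i, j}"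
proof -
  note vertices = vertices_in_corner_tile[of k, unfolded filled]
  show "k mod n \<in> {i, j}"
    using consecutive_vertices_in_coherent_tile[OF indices \<open>k < 2 * n\<close> vertices(1,2)] .
  show "Suc k mod n \<in> {i, j}"
  proof (cases "Suc k < 2 * n")
    case True
    then show ?thesis
      using consecutive_vertices_in_coherent_tile[OF indices _ vertices(2,3)] by simp
  next
    case False
    with \<open>k < 2 * n\<close> have top: "Suc k = 2 * n"
      by simp
    then have "vertex 0 \<in> coherent_tile i j" "vertex (Suc 0) \<in> coherent_tile i j"
      using vertices(2,3) vertex_add_2n[of 0] vertex_add_2n[of 1] by simp_all
    then show ?thesis
      using consecutive_vertices_in_coherent_tile[OF indices, of 0] n_gt_1 by (simp add: top)
  qed
qed

lemma corner_tile_eq_coherent_tile: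
  assumes "2 < n" "k < 2 * n" and indices: "i < j" "j < n"
    and filled: "corner_tile k = coherent_tile i j"
  shows "k \<in> {0, n - 1, 2 * n - 2}"
proof -
  note vertices = vertices_in_corner_tile[of k, unfolded filled]
  note first_vertex = vertex_in_coherent_tile[OF indices vertices(1)]
    and middle_vertex = vertex_in_coherent_tile[OF indices vertices(2)]
    and dirs = corner_tile_eq_coherent_tile_dirs[OF \<open>k < 2 * n\<close> indices filled]
  consider (left) "Suc k < n" | (bottom) "Suc k = n" | (right) "n \<le> k" "Suc k < 2 * n"
    | (top) "Suc k = 2 * n"
    using \<open>k < 2 * n\<close> by linarith
  then show ?thesis
  proof cases
    case left
    then have "i = k" "j = Suc k"
      using dirs indices by auto
    with first_vertex[of 0] left show ?thesis
      by auto
  next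
    case right
    define l where "l = k - n"
    have k_eq: "k = l + n" "Suc l < n"
      using right by (auto simp: l_def)
    then have "k mod n = l" "Suc k mod n = Suc l"
      using mod_add_self2[of "Suc l" n] by simp_all
    then have "i = l" "j = Suc l"
      using dirs indices by auto
    with middle_vertex[of "n - 1"] k_eq show ?thesis
      by force
  next
    case top
    then have "k mod n = n - 1" "Suc k mod n = 0"
      using n_gt_1 by (simp_all add: mod_if) linarith
    then have "i = 0" "j = n - 1"
      using dirs indices \<open>2 < n\<close> by auto
    moreover have "1 < n - 1" "1 < n"
      using \<open>2 < n\<close> by simp_all
    ultimately show ?thesis
      using middle_vertex[of 1] top by auto
  qed auto
qed

lemma card_filled_corners_coherent_tiling:
  assumes "2 < n"
  shows "card (filled_corners coherent_tiling) = 3"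
proof (rule antisym)
  have "filled_corners coherent_tiling \<subseteq> {0, n - 1, 2 * n - 2}"
    using corner_tile_eq_coherent_tile[OF assms]
    by (auto simp: filled_corners_def coherent_tiling_def)
  then have "card (filled_corners coherent_tiling) \<le> card {0, n - 1, 2 * n - 2}"
    by (intro card_mono) auto
  also have "\<dots> \<le> 3"
    by (simp add: card_insert_if)
  finally show "card (filled_corners coherent_tiling) \<le> 3" .
qed (rule card_filled_corners_ge_3[OF coherent_tiling_in_tilings])

end

subsection \<open>Elnitsky's polygon of the longest element\<close>

text \<open>Label \<open>i\<close> is borne by the sides \<open>i - 1\<close> (left) and \<open>n + i - 1\<close> (right) of the zonogon.\<close>

definition elnitsky_dir :: "nat \<Rightarrow> (nat \<Rightarrow> real) \<Rightarrow> nat \<Rightarrow> complex" where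
  "elnitsky_dir n \<theta> k = (-1) ^ (k div n) *\<^sub>R cis (\<theta> (Suc (k mod n)))"

lemma sin_side_angles_diff_pos:
  assumes "side_angles n \<theta>" "i < j" "j < n"
  shows "0 < sin (\<theta> (Suc j) - \<theta> (Suc i))"
proof (rule sin_gt_zero)
  show "0 < \<theta> (Suc j) - \<theta> (Suc i)"
    using assms by (auto simp: side_angles_def strict_mono_on_def)
  have "\<theta> (Suc j) < 2 * pi" "pi < \<theta> (Suc i)"
    using assms by (auto simp: side_angles_def)
  then show "\<theta> (Suc j) - \<theta> (Suc i) < pi"
    by simp
qed

locale longest_elnitsky_polygon =
  fixes n :: nat and \<theta> :: "nat \<Rightarrow> real"
  assumes n_gt_1: "1 < n" and side_angles: "side_angles n \<theta>"

sublocale longest_elnitsky_polygon \<subseteq> zonogon n "elnitsky_dir n \<theta>"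
proof
  show "elnitsky_dir n \<theta> (k + n) = - elnitsky_dir n \<theta> k" for k
    using n_gt_1 by (simp add: elnitsky_dir_def)
  show "0 < det2 (elnitsky_dir n \<theta> k) (elnitsky_dir n \<theta> m)" if indices: "k < m" "m < k + n" for k m
  proof -
    define q r where "q = k div n" and "r = k mod n"
    have k_eq: "k = q * n + r" "r < n"
      using n_gt_1 by (auto simp: q_def r_def)
    define i where "i = m - q * n"
    have m_eq: "m = q * n + i" "r < i" "i < r + n"
      using indices k_eq by (auto simp: i_def)
    have k_div_mod: "k div n = q" "k mod n = r"
      by (simp_all add: q_def r_def)
    have det2_eq: "det2 (elnitsky_dir n \<theta> k) (elnitsky_dir n \<theta> m) =
        (-1) ^ (k div n + m div n) * sin (\<theta> (Suc (m mod n)) - \<theta> (Suc (k mod n)))"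
      by (simp add: elnitsky_dir_def det2_cis power_add)
    show ?thesis
    proof (cases "i < n")
      case True
      then have "m div n = q" "m mod n = i"
        using m_eq by auto
      with sin_side_angles_diff_pos[OF side_angles m_eq(2) True] show ?thesis
        unfolding det2_eq k_div_mod by (simp flip: mult_2)
    next
      case False
      then have "m = Suc q * n + (i - n)" "i - n < r"
        using m_eq by auto
      then have "m div n = Suc q" "m mod n = i - n"
        using k_eq(2) by (simp_all only: div_mult_self3 mod_mult_self3) auto
      with sin_side_angles_diff_pos[OF side_angles \<open>i - n < r\<close> k_eq(2)] show ?thesis
        unfolding det2_eq k_div_mod using sin_minus[of "\<theta> (Suc r) - \<theta> (Suc (i - n))"]
        by (simp flip: mult_2)
    qed
  qed
qed (rule n_gt_1)

context longest_elnitsky_polygon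
begin

abbreviation w0 :: "nat \<Rightarrow> nat" where
  "w0 \<equiv> longest_perm n"

lemma cis_side_angle: "l < n \<Longrightarrow> cis (\<theta> (Suc l)) = elnitsky_dir n \<theta> l"
  by (simp add: elnitsky_dir_def)

lemma left_vertex_eq: "k \<le> n \<Longrightarrow> left_vertex \<theta> k = vertex k"
  by (induction k) (simp_all add: left_vertex_def vertex_Suc cis_side_angle)

lemma right_vertex_eq: "k \<le> n \<Longrightarrow> right_vertex \<theta> w0 k = vertex (2 * n - k)"
proof (induction k)
  case 0
  show ?case
    using vertex_add_2n[of 0] by (simp add: right_vertex_def)
next
  case (Suc k)
  define m where "m = n - Suc k"
  have indices: "2 * n - k = Suc (m + n)" "2 * n - Suc k = m + n" "w0 (Suc k) = Suc m" "m < n"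
    using Suc.prems by (auto simp: m_def longest_perm_def)
  have "right_vertex \<theta> w0 (Suc k) = vertex (Suc (m + n)) + cis (\<theta> (Suc m))"
    using Suc by (simp add: right_vertex_def indices)
  also have "\<dots> = vertex (m + n)"
    using indices(4) by (simp add: vertex_Suc cis_side_angle)
  finally show ?case
    by (simp only: indices)
qed

lemma elnitsky_boundary_eq: "elnitsky_boundary n \<theta> w0 = frontier polygon"
proof -
  have left: "closed_segment (left_vertex \<theta> (k - 1)) (left_vertex \<theta> k) = side (k - 1)"
    if "k \<in> {1..n}" for k
  proof -
    have "k = Suc (k - 1)" "k - 1 \<le> n" "k \<le> n"
      using that by auto
    then show ?thesis
      by (metis left_vertex_eq side_def)
  qed
  have right: "closed_segment (right_vertex \<theta> w0 (k - 1)) (right_vertex \<theta> w0 k) = side (2 * n - k)"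
    if "k \<in> {1..n}" for k
  proof -
    have "2 * n - (k - 1) = Suc (2 * n - k)" "k - 1 \<le> n" "k \<le> n"
      using that by auto
    then show ?thesis
      by (simp add: right_vertex_eq side_def closed_segment_commute)
  qed
  have sides: "{..<2 * n} = (\<lambda>k. k - 1) ` {1..n} \<union> (\<lambda>k. 2 * n - k) ` {1..n}"
  proof (intro equalityI subsetI)
    fix k assume "k \<in> {..<2 * n}"
    then have "k = Suc k - 1 \<and> Suc k \<in> {1..n} \<or> k = 2 * n - (2 * n - k) \<and> 2 * n - k \<in> {1..n}"
      by auto
    then show "k \<in> (\<lambda>k. k - 1) ` {1..n} \<union> (\<lambda>k. 2 * n - k) ` {1..n}"
      by blast
  qed auto
  have "elnitsky_boundary n \<theta> w0 = (\<Union>k\<in>{1..n}. side (k - 1)) \<union> (\<Union>k\<in>{1..n}. side (2 * n - k))"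
    by (simp only: elnitsky_boundary_def left right cong: SUP_cong)
  also have "\<dots> = frontier polygon"
    by (simp only: frontier_polygon sides UN_Un image_image)
  finally show ?thesis .
qed

lemma elnitsky_polygon_eq: "elnitsky_polygon n \<theta> w0 = polygon"
proof -
  have "inside (frontier polygon) = interior polygon"
    by (intro inside_frontier_eq_interior compact_imp_bounded compact_zonotope convex_zonotope)
  moreover have "closure polygon = polygon"
    by (intro closure_closed compact_imp_closed compact_zonotope)
  ultimately show ?thesis
    unfolding elnitsky_polygon_def elnitsky_boundary_eq
    using interior_subset[of polygon] by (auto simp: frontier_def)
qed

lemma dir_eq_cis_or_uminus_cis:
  assumes "a \<in> range (elnitsky_dir n \<theta>)"
  obtains i where "i \<in> {1..n}" "a = cis (\<theta> i) \<or> a = - cis (\<theta> i)"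
proof -
  obtain k where "a = elnitsky_dir n \<theta> k"
    using assms by blast
  then have "a = cis (\<theta> (Suc (k mod n))) \<or> a = - cis (\<theta> (Suc (k mod n)))"
    by (cases "even (k div n)") (simp_all add: elnitsky_dir_def)
  moreover have "Suc (k mod n) \<in> {1..n}"
    using n_gt_1 by (simp add: Suc_le_eq)
  ultimately show thesis
    using that by blast
qed

lemma tile_if_is_tile:
  assumes "is_tile n \<theta> R"
  shows "tile R"
proof -
  obtain p i j where labels: "i \<in> {1..n}" "j \<in> {1..n}" "i \<noteq> j"
    and R_eq: "R = parallelogram p (cis (\<theta> i)) (cis (\<theta> j))"
    using assms unfolding is_tile_def by blast
  define a b where "a = i - 1" and "b = j - 1"
  have indices: "a < n" "b < n" "a \<noteq> b" "i = Suc a" "j = Suc b"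
    using labels by (auto simp: a_def b_def)
  have "det2 (elnitsky_dir n \<theta> a) (elnitsky_dir n \<theta> b) \<noteq> 0"
    using det2_dir_pos[of a b] det2_dir_pos[of b a] indices(1-3)
      det2_commute[of "elnitsky_dir n \<theta> a" "elnitsky_dir n \<theta> b"]
    by (cases a b rule: linorder_cases) auto
  with indices R_eq show ?thesis
    unfolding tile_def by (auto simp: cis_side_angle)
qed

lemma is_tile_if_tile:
  assumes "tile R"
  shows "is_tile n \<theta> R"
proof -
  obtain p a b where spanned: "a \<in> range (elnitsky_dir n \<theta>)" "b \<in> range (elnitsky_dir n \<theta>)"
      "det2 a b \<noteq> 0"
    and R_eq: "R = parallelogram p a b"
    using assms unfolding tile_def by blast
  obtain i where label_a: "i \<in> {1..n}" "a = cis (\<theta> i) \<or> a = - cis (\<theta> i)"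
    using dir_eq_cis_or_uminus_cis[OF spanned(1)] .
  obtain j where label_b: "j \<in> {1..n}" "b = cis (\<theta> j) \<or> b = - cis (\<theta> j)"
    using dir_eq_cis_or_uminus_cis[OF spanned(2)] .
  have flip_first: "\<exists>q. parallelogram p (- a) b = parallelogram q a b" for p a b
    using parallelogram_flip[of p "- a" b] by auto
  then have "\<exists>q. parallelogram p a (- b) = parallelogram q a b" for p a b
    by (metis parallelogram_swap)
  with flip_first have "\<exists>q. parallelogram p a b = parallelogram q (cis (\<theta> i)) (cis (\<theta> j))"
    using label_a(2) label_b(2) by metis
  moreover have "i \<noteq> j"
    using spanned(3) label_a(2) label_b(2) by auto
  ultimately show ?thesis
    unfolding is_tile_def R_eq using label_a(1) label_b(1) by blast
qed

lemma rhombic_tilings_eq: "rhombic_tilings n \<theta> w0 = tilings"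
proof -
  have tile_iff: "is_tile n \<theta> R \<longleftrightarrow> tile R" for R
    using tile_if_is_tile is_tile_if_tile by blast
  show ?thesis
    by (simp add: rhombic_tilings_def tilings_def tile_iff elnitsky_polygon_eq)
qed

lemma perim_eq_card_filled_corners:
  assumes "2 < n" "T \<in> tilings"
  shows "perim n \<theta> w0 T = card (filled_corners T)"
proof -
  have "perimeter_tile n \<theta> w0 R \<longleftrightarrow> shares_boundary_path (frontier polygon) R" for R
    by (simp add: perimeter_tile_def shares_boundary_path_def elnitsky_boundary_eq)
  then show ?thesis
    using card_shares_boundary_path[OF assms] by (simp add: perim_def)
qed

end

theorem theorem3p5:
  fixes n :: nat and \<theta> :: "nat \<Rightarrow> real"
  assumes "n > 2" and "side_angles n \<theta>"
  shows "(\<exists>T \<in> rhombic_tilings n \<theta> (longest_perm n). perim n \<theta> (longest_perm n) T = 3) \<and>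
         (\<forall>T \<in> rhombic_tilings n \<theta> (longest_perm n). 3 \<le> perim n \<theta> (longest_perm n) T)"
proof -
  interpret longest_elnitsky_polygon n \<theta>
    using assms by unfold_locales auto
  have "perim n \<theta> w0 coherent_tiling = 3"
    using perim_eq_card_filled_corners[OF assms(1) coherent_tiling_in_tilings]
      card_filled_corners_coherent_tiling[OF assms(1)] by simp
  moreover have "3 \<le> perim n \<theta> w0 T" if "T \<in> tilings" for T
    using perim_eq_card_filled_corners[OF assms(1) that] card_filled_corners_ge_3[OF that] by simp
  ultimately show ?thesis
    unfolding rhombic_tilings_eq using coherent_tiling_in_tilings by blast
qed

end
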